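(* Let $T\in\mathbb Z^{m\times s}$ be an integer matrix such that $I_T\subset K[x_1,\dots,x_s]$ is a simple toric ideal, and let $\omega\subseteq\{1,\dots,s\}$. The set $\omega$ is a face of the strongly robustness complex $\Delta_T$ if and only if $\Lambda(T)_\omega$ is strongly robust (i.e. the toric ideal $I_{\Lambda(T)_\omega}$ is strongly robust).
   Context: $\Lambda(T)$ is the second Lawrence lifting of $T$, the $(m+s)\times 2s$ matrix $\begin{pmatrix} T&0\\ I_s&I_s\end{pmatrix}$ with $I_s$ the $s\times s$ identity matrix (in this display only). $\Lambda(T)_\omega$ is the matrix obtained from $\Lambda(T)$ by removing the $(m+i)$-th row and the $(s+i)$-th column for each $i\in\omega$. $K$ is a field. For an integer matrix $M$ with $n$ columns, $\operatorname{Ker}_{\mathbb Z}(M)=\{\mathbf u\in\mathbb Z^n: M\mathbf u=0\}$, and the toric ideal $I_M\subset K[x_1,\dots,x_n]$ is generated by the binomials $x^{\mathbf u^+}-x^{\mathbf u^-}$, $\mathbf u\in\operatorname{Ker}_{\mathbb Z}(M)$, where $\mathbf u=\mathbf u^+-\mathbf u^-$ with $\mathbf u^\pm\in\mathbb N^n$ of disjoint supports. Standing assumption: all toric ideals considered (in particular $I_T$) come from matrices $M$ with $\operatorname{Ker}_{\mathbb Z}(M)\cap\mathbb N^n=\{\mathbf 0\}$ (positively graded). Bouquets. Let $A=[\mathbf a_1,\dots,\mathbf a_n]\in\mathbb Z^{m'\times n}$ have rank $r$. Its Gale transform is an $n\times(n-r)$ integer matrix whose columns form a basis of the lattice $\operatorname{Ker}_{\mathbb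 Z}(A)$; its rows are $\mathbf b_1,\dots,\mathbf b_n$. The vector $\mathbf a_i$ is free if $\mathbf b_i=\mathbf 0$. The bouquet graph has vertices $\mathbf a_1,\dots,\mathbf a_n$ and edges $\{\mathbf a_i,\mathbf a_j\}$ whenever $\mathbf b_i$ is a rational multiple of $\mathbf b_j$ and vice versa; its connected components are the bouquets. The free vectors, if any, form one bouquet, the free bouquet. A non-free bouquet is mixed if it contains an edge $\{\mathbf a_i,\mathbf a_j\}$ with $\mathbf b_i=\lambda\mathbf b_j$ for some $\lambda<0$; otherwise (isolated vertex, or $\lambda>0$ for all its edges) it is non-mixed. List the bouquets as $B_1,\dots,B_s$ and reorder the columns as $\mathbf a_{11},\dots,\mathbf a_{1k_1},\dots,\mathbf a_{s1},\dots,\mathbf a_{sk_s}$, with $\mathbf a_{i1},\dots,\mathbf a_{ik_i}$ the elements of $B_i$. Define $\mathbf c_{B_i}\in\mathbb Z^n$, supported on the positions $i1,\dots,ik_i$ with coordinates $c_{i1},\dots,c_{ik_i}$ there: if $B_i$ is free, $\mathbf c_{B_i}$ is any vector with support exactly $\{i1,\dots,ik_i\}$ and $c_{i1}>0$; if $B_i$ is non-free, choose an index $l$ with $(\mathbf b_{ij})_l\neq0$ for all $j$, put $g_l=\gcd((\mathbf b_{i1})_l,\dots,(\mathbf b_{ik_i})_l)$ and $c_{ij}=\varepsilon_{i1}(\mathbf b_{ij})_l/g_l$, where $\varepsilon_{i1}$ is the sign of $(\mathbf b_{i1})_l$. Let $\mathbf a_{B_i}=\sum_j c_{ij}\mathbf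 a_{ij}$ and $A_B=[\mathbf a_{B_1},\dots,\mathbf a_{B_s}]$; the bouquet ideal of $I_A$ is $I_{A_B}\subset K[x_1,\dots,x_s]$. The map $D(\mathbf u)=\sum_{i=1}^s u_i\mathbf c_{B_i}$ is an isomorphism $\operatorname{Ker}_{\mathbb Z}(A_B)\to\operatorname{Ker}_{\mathbb Z}(A)$ (known fact). A toric ideal is simple if every bouquet is a singleton. Given a simple toric ideal $I_T\subset K[x_1,\dots,x_s]$ and $\omega\subseteq[s]=\{1,\dots,s\}$, a toric ideal $I_A$ is $T_\omega$-robust if its bouquet ideal is $I_T$ (so $\operatorname{Ker}_{\mathbb Z}(A_B)=\operatorname{Ker}_{\mathbb Z}(T)$, the bouquet $B_i$ corresponding to $x_i$) and $\omega=\{i: B_i\text{ is non-mixed}\}$. A binomial $x^{\mathbf u^+}-x^{\mathbf u^-}\in I_M$ is primitive if there is no other binomial $x^{\mathbf v^+}-x^{\mathbf v^-}\in I_M$ with $x^{\mathbf v^+}\mid x^{\mathbf u^+}$ and $x^{\mathbf v^-}\mid x^{\mathbf u^-}$ (here $\mathbf u,\mathbf v\neq\mathbf 0$). The Graver basis $\operatorname{Gr}(I_M)$ is the set of primitive binomials, and $\operatorname{Gr}(M)$ is the set of corresponding vectors $\mathbf u$. The set $S(M)$ of indispensable elements is the set of $\mathbf u\in\operatorname{Ker}_{\mathbb Z}(M)$ such that $x^{\mathbf u^+}-x^{\mathbf u^-}$ belongs, up to sign, to every minimal system of binomial generators of $I_M$. Opposite vectors (binomials) are identified in these sets. $I_M$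 is strongly robust if its Graver basis is a minimal system of generators of $I_M$. For $\omega\subseteq[s]$, $S_\omega(T)=\{\mathbf u\in\operatorname{Gr}(T): D(\mathbf u)\in S(A)\}$, where $I_A$ is any $T_\omega$-robust toric ideal (this is independent of the choice of $I_A$). The strongly robustness complex of $T$ is $\Delta_T=\{\omega\subseteq[s]: S_\omega(T)=\operatorname{Gr}(T)\}$.
   Formalization: If T has a free column i and i lies in ω, no T_ω-robust ideal exists, so S_ω(T) is undefined; the formal version requires "i ∈ ω iff B_i is non-mixed" only for non-free bouquets, which agrees with the original definition in all other cases. *)

theory Defs
  imports
    "HOL-Library.Poly_Mapping"
    "HOL-Algebra.Ideal"
    "HOL-Algebra.Divisibility"
    "Jordan_Normal_Form.Matrix_Kernel"
    "Jordan_Normal_Form.DL_Submatrix"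
begin

text \<open>
  Rows, columns, coordinates and variables are numbered from 0, so \<open>[s]\<close> is \<open>{..<s}\<close>.
  The argument \<open>K :: 'k itself\<close> only names the coefficient field.
\<close>

section \<open>Toric ideals\<close>

type_synonym 'k mpoly = "(nat \<Rightarrow>\<^sub>0 nat) \<Rightarrow>\<^sub>0 'k"

definition poly_ring :: "'k::field itself \<Rightarrow> nat \<Rightarrow> 'k mpoly ring" where
  "poly_ring K n =
    \<lparr>carrier = {p. \<forall>t\<in>Poly_Mapping.keys p. Poly_Mapping.keys t \<subseteq> {..<n}},
     monoid.mult = (*), one = 1, zero = 0, add = (+)\<rparr>"

lemma cring_poly_ring: "cring (poly_ring K n)"
proof (rule cringI)
  show "abelian_group (poly_ring K n)"
  proof (rule abelian_groupI)
    fix p assume p: "p \<in> carrier (poly_ring K n)"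
    show "\<exists>q\<in>carrier (poly_ring K n). q \<oplus>\<^bsub>poly_ring K n\<^esub> p = \<zero>\<^bsub>poly_ring K n\<^esub>"
      by (rule bexI[of _ "- p"]) (use p in \<open>auto simp: poly_ring_def\<close>)
  next
    fix p q assume "p \<in> carrier (poly_ring K n)" "q \<in> carrier (poly_ring K n)"
    then show "p \<oplus>\<^bsub>poly_ring K n\<^esub> q \<in> carrier (poly_ring K n)"
      using keys_add[of p q] by (fastforce simp: poly_ring_def)
  qed (auto simp: poly_ring_def ac_simps)
  show "comm_monoid (poly_ring K n)"
  proof (rule comm_monoidI)
    fix p q assume pq: "p \<in> carrier (poly_ring K n)" "q \<in> carrier (poly_ring K n)"
    have "Poly_Mapping.keys t \<subseteq> {..<n}" if "t \<in> Poly_Mapping.keys (p * q)" for t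
    proof -
      obtain a b where ab: "t = a + b" "a \<in> Poly_Mapping.keys p" "b \<in> Poly_Mapping.keys q"
        using \<open>t \<in> Poly_Mapping.keys (p * q)\<close> keys_mult[of p q] by blast
      then show ?thesis
        using pq keys_add[of a b] by (fastforce simp: poly_ring_def)
    qed
    then show "p \<otimes>\<^bsub>poly_ring K n\<^esub> q \<in> carrier (poly_ring K n)"
      by (simp add: poly_ring_def)
  qed (auto simp: poly_ring_def ac_simps)
qed (simp add: poly_ring_def distrib_right)

definition positive_part :: "int vec \<Rightarrow> (nat \<Rightarrow>\<^sub>0 nat)" where
  "positive_part u = (\<Sum>i<dim_vec u. Poly_Mapping.single i (nat (u $ i)))"

definition monomial :: "'k::field itself \<Rightarrow> (nat \<Rightarrow>\<^sub>0 nat) \<Rightarrow> 'k mpoly" where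
  "monomial K t = Poly_Mapping.single t 1"

abbreviation monomial_pos :: "'k::field itself \<Rightarrow> int vec \<Rightarrow> 'k mpoly" where
  "monomial_pos K u \<equiv> monomial K (positive_part u)"

abbreviation monomial_neg :: "'k::field itself \<Rightarrow> int vec \<Rightarrow> 'k mpoly" where
  "monomial_neg K u \<equiv> monomial K (positive_part (- u))"

definition binomial_of :: "'k::field itself \<Rightarrow> int vec \<Rightarrow> 'k mpoly" where
  "binomial_of K u = monomial_pos K u - monomial_neg K u"

definition toric_ideal :: "'k::field itself \<Rightarrow> int mat \<Rightarrow> 'k mpoly set" where
  "toric_ideal K M = Idl\<^bsub>poly_ring K (dim_col M)\<^esub> (binomial_of K ` mat_kernel M)"

definition positively_graded :: "int mat \<Rightarrow> bool" where
  "positively_graded M \<longleftrightarrow>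
    mat_kernel M \<inter> {u. \<forall>i<dim_vec u. 0 \<le> u $ i} = {0\<^sub>v (dim_col M)}"

section \<open>Graver basis, indispensable elements, strong robustness\<close>

definition primitive :: "'k::field itself \<Rightarrow> int mat \<Rightarrow> int vec \<Rightarrow> bool" where
  "primitive K M u \<longleftrightarrow>
    u \<in> carrier_vec (dim_col M) \<and> u \<noteq> 0\<^sub>v (dim_col M) \<and> binomial_of K u \<in> toric_ideal K M \<and>
    \<not> (\<exists>v\<in>carrier_vec (dim_col M). v \<noteq> 0\<^sub>v (dim_col M) \<and> v \<noteq> u \<and>
          binomial_of K v \<in> toric_ideal K M \<and>
          monomial_pos K v divides\<^bsub>poly_ring K (dim_col M)\<^esub> monomial_pos K u \<and>
          monomial_neg K v divides\<^bsub>poly_ring K (dim_col M)\<^esub> monomial_neg K u)"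

text \<open>
  The sets \<open>graver\<close> and \<open>indispensable\<close> contain both members of each pair of opposite vectors;
  opposite binomials are identified only where this matters, in \<open>strongly_robust\<close>.
\<close>

definition graver :: "'k::field itself \<Rightarrow> int mat \<Rightarrow> int vec set" where
  "graver K M = {u. primitive K M u}"

definition minimal_generators :: "'k::field itself \<Rightarrow> int mat \<Rightarrow> 'k mpoly set \<Rightarrow> bool" where
  "minimal_generators K M F \<longleftrightarrow>
    F \<subseteq> toric_ideal K M \<and>
    Idl\<^bsub>poly_ring K (dim_col M)\<^esub> F = toric_ideal K M \<and>
    (\<forall>F'. F' \<subset> F \<longrightarrow> Idl\<^bsub>poly_ring K (dim_col M)\<^esub> F' \<noteq> toric_ideal K M)"

definition indispensable :: "'k::field itself \<Rightarrow> int mat \<Rightarrow> int vec set" where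
  "indispensable K M =
    {u \<in> mat_kernel M.
      \<forall>F. F \<subseteq> binomial_of K ` carrier_vec (dim_col M) \<and> minimal_generators K M F \<longrightarrow>
        binomial_of K u \<in> F \<or> - binomial_of K u \<in> F}"

definition sign_representatives :: "'a::uminus set \<Rightarrow> 'a set \<Rightarrow> bool" where
  "sign_representatives F B \<longleftrightarrow> F \<subseteq> B \<and> (\<forall>b\<in>B. \<exists>!f. f \<in> F \<and> (f = b \<or> f = - b))"

definition strongly_robust :: "'k::field itself \<Rightarrow> int mat \<Rightarrow> bool" where
  "strongly_robust K M \<longleftrightarrow>
    (\<exists>F. sign_representatives F (binomial_of K ` graver K M) \<and> minimal_generators K M F)"

section \<open>Bouquets\<close>

text \<open>
  The columns of \<open>G\<close> form a lattice basis of the integer kernel of \<open>A\<close>; their number is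
  therefore \<open>dim_col A\<close> minus the rank of \<open>A\<close>.
\<close>

definition gale_transform :: "int mat \<Rightarrow> int mat \<Rightarrow> bool" where
  "gale_transform A G \<longleftrightarrow>
    dim_row G = dim_col A \<and>
    bij_betw (\<lambda>x. G *\<^sub>v x) (carrier_vec (dim_col G)) (mat_kernel A)"

abbreviation gale_row :: "int mat \<Rightarrow> nat \<Rightarrow> rat vec" where
  "gale_row G i \<equiv> map_vec rat_of_int (row G i)"

definition bouquet_edges :: "int mat \<Rightarrow> (nat \<times> nat) set" where
  "bouquet_edges G =
    {(i, j). i < dim_row G \<and> j < dim_row G \<and> i \<noteq> j \<and>
      (\<exists>c. gale_row G i = c \<cdot>\<^sub>v gale_row G j) \<and> (\<exists>c. gale_row G j = c \<cdot>\<^sub>v gale_row G i)}"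

text \<open>The connected components of the bouquet graph, as sets of column indices.\<close>

definition bouquets :: "int mat \<Rightarrow> nat set set" where
  "bouquets G = {..<dim_row G} // (bouquet_edges G)\<^sup>*"

definition free_index :: "int mat \<Rightarrow> nat \<Rightarrow> bool" where
  "free_index G i \<longleftrightarrow> row G i = 0\<^sub>v (dim_col G)"

definition free_bouquet :: "int mat \<Rightarrow> nat set \<Rightarrow> bool" where
  "free_bouquet G B \<longleftrightarrow> (\<forall>i\<in>B. free_index G i)"

definition mixed_bouquet :: "int mat \<Rightarrow> nat set \<Rightarrow> bool" where
  "mixed_bouquet G B \<longleftrightarrow>
    \<not> free_bouquet G B \<and>
    (\<exists>i\<in>B. \<exists>j\<in>B. (i, j) \<in> bouquet_edges G \<and>
      (\<exists>c<0. gale_row G i = c \<cdot>\<^sub>v gale_row G j))"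

definition non_mixed_bouquet :: "int mat \<Rightarrow> nat set \<Rightarrow> bool" where
  "non_mixed_bouquet G B \<longleftrightarrow> \<not> free_bouquet G B \<and> \<not> mixed_bouquet G B"

definition simple_toric :: "int mat \<Rightarrow> bool" where
  "simple_toric M \<longleftrightarrow> (\<exists>G. gale_transform M G \<and> (\<forall>B\<in>bouquets G. is_singleton B))"

text \<open>
  \<open>bouquet_vector G B c\<close>: \<open>c\<close> is a vector \<open>c_B\<close> of the bouquet \<open>set B\<close>. The list \<open>B\<close>
  enumerates the bouquet; its head is the index \<open>i1\<close> that fixes the sign of \<open>c_B\<close>.
\<close>

definition bouquet_vector :: "int mat \<Rightarrow> nat list \<Rightarrow> int vec \<Rightarrow> bool" where
  "bouquet_vector G B c \<longleftrightarrow>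
    c \<in> carrier_vec (dim_row G) \<and>
    (\<forall>j<dim_row G. j \<notin> set B \<longrightarrow> c $ j = 0) \<and>
    (if free_bouquet G (set B)
     then (\<forall>j\<in>set B. c $ j \<noteq> 0) \<and> c $ hd B > 0
     else \<exists>l<dim_col G. (\<forall>j\<in>set B. G $$ (j, l) \<noteq> 0) \<and>
       (\<forall>j\<in>set B. c $ j =
          sgn (G $$ (hd B, l)) * (G $$ (j, l) div Gcd ((\<lambda>i. G $$ (i, l)) ` set B))))"

text \<open>
  \<open>Bs\<close> lists the bouquets (so \<open>concat Bs\<close> is the reordering of the columns of \<open>A\<close>), and column
  \<open>i\<close> of \<open>C\<close> is the vector of the \<open>i\<close>-th bouquet. Hence \<open>A * C\<close> is the matrix \<open>A_B\<close>, and the map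
  \<open>D(u) = \<Sum>i. u_i c_{B_i}\<close> is \<open>u \<mapsto> C *\<^sub>v u\<close>.
\<close>

definition bouquet_decomposition ::
    "int mat \<Rightarrow> int mat \<Rightarrow> nat list list \<Rightarrow> int mat \<Rightarrow> bool" where
  "bouquet_decomposition A G Bs C \<longleftrightarrow>
    gale_transform A G \<and>
    distinct (concat Bs) \<and> set ` set Bs = bouquets G \<and>
    C \<in> carrier_mat (dim_col A) (length Bs) \<and>
    (\<forall>i<length Bs. bouquet_vector G (Bs ! i) (col C i))"

definition bouquet_map :: "int mat \<Rightarrow> int vec \<Rightarrow> int vec" where
  "bouquet_map C u = C *\<^sub>v u"

section \<open>The strongly robustness complex\<close>

text \<open>
  A free bouquet is neither mixed nor non-mixed. A simple \<open>T\<close> may have one free column \<open>i\<close>; then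
  \<open>B_i\<close> is free for every \<open>A\<close> with bouquet ideal \<open>I_T\<close>, and requiring \<open>i \<notin> \<omega>\<close> would leave no
  \<open>T_\<omega>\<close>-robust ideal at all when \<open>i \<in> \<omega>\<close>. The last clause therefore constrains only the non-free
  bouquets. For \<open>T\<close> without free columns, and for \<open>\<omega>\<close> not containing the free index, it says
  exactly \<open>\<omega> = {i. B_i is non-mixed}\<close>.
\<close>

definition T_robust ::
    "'k::field itself \<Rightarrow> int mat \<Rightarrow> nat set \<Rightarrow>
     int mat \<Rightarrow> int mat \<Rightarrow> nat list list \<Rightarrow> int mat \<Rightarrow> bool" where
  "T_robust K T \<omega> A G Bs C \<longleftrightarrow>
    positively_graded A \<and>
    bouquet_decomposition A G Bs C \<and>
    length Bs = dim_col T \<and> toric_ideal K (A * C) = toric_ideal K T \<and>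
    (\<forall>i<length Bs. \<not> free_bouquet G (set (Bs ! i)) \<longrightarrow>
       (i \<in> \<omega> \<longleftrightarrow> non_mixed_bouquet G (set (Bs ! i))))"

text \<open>
  Whether \<open>D(u)\<close> is indispensable does not depend on the choice of the \<open>T_\<omega>\<close>-robust ideal, so the
  existential quantifier refers to an arbitrary one.
\<close>

definition S_omega :: "'k::field itself \<Rightarrow> int mat \<Rightarrow> nat set \<Rightarrow> int vec set" where
  "S_omega K T \<omega> =
    {u \<in> graver K T. \<exists>A G Bs C. T_robust K T \<omega> A G Bs C \<and>
        bouquet_map C u \<in> indispensable K A}"

definition strongly_robustness_complex :: "'k::field itself \<Rightarrow> int mat \<Rightarrow> nat set set" where
  "strongly_robustness_complex K T = {\<omega>. \<omega> \<subseteq> {..<dim_col T} \<and> S_omega K T \<omega> = graver K T}"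

section \<open>The second Lawrence lifting\<close>

definition lawrence :: "int mat \<Rightarrow> int mat" where
  "lawrence T = four_block_mat T (0\<^sub>m (dim_row T) (dim_col T)) (1\<^sub>m (dim_col T)) (1\<^sub>m (dim_col T))"

definition lawrence_omega :: "int mat \<Rightarrow> nat set \<Rightarrow> int mat" where
  "lawrence_omega T \<omega> =
    submatrix (lawrence T)
      ({..<dim_row T + dim_col T} - (\<lambda>i. dim_row T + i) ` \<omega>)
      ({..<2 * dim_col T} - (\<lambda>i. dim_col T + i) ` \<omega>)"

end

theory Submission
  imports Defs
begin

text \<open>
  Everything is reduced to the notion of a splitting. A vector \<open>u\<close> in the kernel of \<open>M\<close> splits if
  \<open>u = v + w\<close> with nonzero \<open>v\<close>, \<open>w\<close> in the kernel such that \<open>w\<close> is nonnegative wherever \<open>v\<close> is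
  positive; equivalently, the fiber of \<open>x^u\<^sup>+\<close> contains a monomial other than \<open>x^u\<^sup>+\<close> and \<open>x^u\<^sup>-\<close>.
  For a positively graded \<open>M\<close>, a nonzero \<open>u\<close> is indispensable if and only if it does not split
  (\<open>indispensable_iff\<close>), and \<open>M\<close> is strongly robust if and only if no Graver vector splits
  (\<open>strongly_robust_iff\<close>). In both, a splitting allows the binomial of \<open>u\<close> to be expressed through
  Graver binomials other than itself and its opposite, and without a splitting no other binomial
  applies to the monomial \<open>x^u\<^sup>+\<close>.

  The kernel of \<open>\<Lambda>(T)_\<omega>\<close> consists of the vectors \<open>u\<close> of the kernel of \<open>T\<close>, each followed by the
  entries of \<open>- u\<close> outside \<open>\<omega>\<close>. This embedding \<open>E\<close> respects the conformal order, so it maps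
  \<open>Gr(T)\<close> onto the Graver basis of \<open>\<Lambda>(T)_\<omega>\<close> (\<open>lawrence_graver\<close>), and \<open>\<Lambda>(T)_\<omega>\<close> is strongly robust
  if and only if \<open>E u\<close> does not split for any \<open>u\<close> in \<open>Gr(T)\<close>.

  It remains to compare this with \<open>S_\<omega>(T)\<close>. On the one hand, \<open>\<Lambda>(T)_\<omega>\<close> is itself
  \<open>T_\<omega>\<close>-robust, with \<open>E\<close> as the map \<open>D\<close> (\<open>lawrence_T_robust\<close>): the columns of a variable and of its
  surviving second copy form a bouquet, which is mixed because the copies enter with opposite signs.
  So if no \<open>E u\<close> splits, then \<open>S_\<omega>(T) = Gr(T)\<close>. On the other hand, a splitting of \<open>E u\<close>
  gives a splitting of \<open>D(u)\<close> for every \<open>T_\<omega>\<close>-robust ideal (\<open>splits_transfer\<close>), since the signs that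
  semiconformality compares are prescribed by which bouquets are mixed.
\<close>

section \<open>Semiconformal decompositions\<close>

definition conformal_le :: "int vec \<Rightarrow> int vec \<Rightarrow> bool" where
  "conformal_le v u \<longleftrightarrow>
    (\<forall>i<dim_vec u. 0 \<le> v $ i \<and> v $ i \<le> u $ i \<or> u $ i \<le> v $ i \<and> v $ i \<le> 0)"

text \<open>
  The companion condition, that \<open>v\<close> is nonpositive wherever \<open>w\<close> is negative, is the
  contrapositive of this one.
\<close>

definition semiconformal :: "int vec \<Rightarrow> int vec \<Rightarrow> bool" where
  "semiconformal v w \<longleftrightarrow> (\<forall>i<dim_vec v. 0 < v $ i \<longrightarrow> 0 \<le> w $ i)"

text \<open>
  For \<open>u\<close> in the kernel, a splitting \<open>u = v + w\<close> amounts to a third monomial in the fiber of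
  \<open>x^u\<^sup>+\<close>, besides \<open>x^u\<^sup>+\<close> and \<open>x^u\<^sup>-\<close>: its exponent is \<open>u\<^sup>+ - v = u\<^sup>- + w\<close>, and semiconformality
  says that this vector is nonnegative. Splittings are preferred to fibers because they compare
  signs coordinate by coordinate, so they can be carried from one kernel to another.
\<close>

definition splits :: "int vec set \<Rightarrow> int vec \<Rightarrow> bool" where
  "splits L u \<longleftrightarrow>
    (\<exists>v\<in>L. \<exists>w\<in>L. v \<noteq> 0\<^sub>v (dim_vec u) \<and> w \<noteq> 0\<^sub>v (dim_vec u) \<and> u = v + w \<and> semiconformal v w)"

lemma lookup_positive_part:
  "poly_mapping.lookup (positive_part u) i = (if i < dim_vec u then nat (u $ i) else 0)"
proof -
  have "poly_mapping.lookup (positive_part u) i = (\<Sum>j<dim_vec u. nat (u $ j) when j = i)"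
    by (simp add: positive_part_def lookup_sum lookup_single)
  also have "\<dots> = (\<Sum>j<dim_vec u. if j = i then nat (u $ j) else 0)"
    by (rule sum.cong) (auto simp: when_def)
  finally show ?thesis by simp
qed

lemma keys_positive_part: "Poly_Mapping.keys (positive_part u) \<subseteq> {..<dim_vec u}"
  by (auto simp: in_keys_iff lookup_positive_part split: if_splits)

lemma positive_part_eq_iff:
  assumes "u \<in> carrier_vec n" "v \<in> carrier_vec n"
  shows "positive_part u = positive_part v \<and> positive_part (- u) = positive_part (- v) \<longleftrightarrow> u = v"
proof
  assume h: "positive_part u = positive_part v \<and> positive_part (- u) = positive_part (- v)"
  have "u $ i = v $ i" if "i < n" for i
  proof -
    from h have "poly_mapping.lookup (positive_part u) i = poly_mapping.lookup (positive_part v) i"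
      "poly_mapping.lookup (positive_part (- u)) i = poly_mapping.lookup (positive_part (- v)) i" by auto
    then show ?thesis using that assms by (auto simp: lookup_positive_part)
  qed
  then show "u = v" using assms by (intro eq_vecI) auto
qed auto

lemma monomial_mult: "monomial K a * monomial K b = monomial K (a + b)"
  by (simp add: monomial_def mult_single)

lemma binomial_of_uminus: "binomial_of K (- u) = - binomial_of K u"
  by (simp add: binomial_of_def)

text \<open>
  The difference of \<open>x^u\<^sup>+\<close> and \<open>x^u\<^sup>-\<close> for \<open>u = v + w\<close> is a walk of two steps through the middle
  monomial \<open>x^(u\<^sup>+ - v)\<close>; the first step is a multiple of the binomial of \<open>v\<close>, the second of that
  of \<open>w\<close>. Semiconformality gives \<open>v\<^sup>+ \<le> u\<^sup>+\<close> and \<open>w\<^sup>- \<le> u\<^sup>-\<close>, so the truncated subtractions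
  in the cofactors are exact.
\<close>

lemma binomial_of_semiconformal:
  assumes v: "v \<in> carrier_vec n" and w: "w \<in> carrier_vec n" and sc: "semiconformal v w"
  shows "binomial_of K (v + w) =
    monomial K (positive_part (v + w) - positive_part v) * binomial_of K v +
    monomial K (positive_part (- (v + w)) - positive_part (- w)) * binomial_of K w"
proof -
  have sc': "0 < v $ i \<Longrightarrow> 0 \<le> w $ i" if "i < n" for i
    using sc v that by (auto simp: semiconformal_def)
  have 1: "positive_part (v + w) - positive_part v + positive_part v = positive_part (v + w)"
    using v w sc' by (intro poly_mapping_eqI)
      (fastforce simp: lookup_add lookup_minus lookup_positive_part)
  have 2: "positive_part (- (v + w)) - positive_part (- w) + positive_part (- w)
      = positive_part (- (v + w))"
    using v w sc' by (intro poly_mapping_eqI)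
      (fastforce simp: lookup_add lookup_minus lookup_positive_part)
  \<comment> \<open>Both sides are the exponent of the middle monomial.\<close>
  have 3: "positive_part (v + w) - positive_part v + positive_part (- v)
    = positive_part (- (v + w)) - positive_part (- w) + positive_part w"
    using v w sc' by (intro poly_mapping_eqI)
      (fastforce simp: lookup_add lookup_minus lookup_positive_part)
  show ?thesis
    unfolding binomial_of_def right_diff_distrib monomial_mult 1 2 3 by simp
qed

section \<open>Ideals generated by binomials\<close>

lemma carrier_poly_ring:
  "p \<in> carrier (poly_ring K n) \<longleftrightarrow> (\<forall>t\<in>Poly_Mapping.keys p. Poly_Mapping.keys t \<subseteq> {..<n})"
  by (simp add: poly_ring_def)

lemma mult_poly_ring: "p \<otimes>\<^bsub>poly_ring K n\<^esub> q = p * q"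
  by (simp add: poly_ring_def)

lemma monomial_carrier: "Poly_Mapping.keys t \<subseteq> {..<n} \<Longrightarrow> monomial K t \<in> carrier (poly_ring K n)"
  by (simp add: carrier_poly_ring monomial_def)

lemma binomial_of_carrier:
  "u \<in> carrier_vec n \<Longrightarrow> binomial_of K u \<in> carrier (poly_ring K n)"
  unfolding carrier_poly_ring binomial_of_def monomial_def
  using keys_diff[of "Poly_Mapping.single (positive_part u) (1::'a)"
      "Poly_Mapping.single (positive_part (- u)) 1"] keys_positive_part[of u] keys_positive_part[of "- u"]
  by fastforce

lemma binomial_image_carrier:
  "V \<subseteq> carrier_vec n \<Longrightarrow> binomial_of K ` V \<subseteq> carrier (poly_ring K n)"
  using binomial_of_carrier by blast

context
  fixes K :: "'k::field itself" and n :: nat and S :: "'k mpoly set"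
  assumes S: "S \<subseteq> carrier (poly_ring K n)"
begin

lemma Idl_ideal: "ideal (Idl\<^bsub>poly_ring K n\<^esub> S) (poly_ring K n)"
  using S cring_poly_ring cring.axioms(1) ring.genideal_ideal by blast

lemma Idl_add:
  "p \<in> Idl\<^bsub>poly_ring K n\<^esub> S \<Longrightarrow> q \<in> Idl\<^bsub>poly_ring K n\<^esub> S \<Longrightarrow> p + q \<in> Idl\<^bsub>poly_ring K n\<^esub> S"
  using additive_subgroup.a_closed[OF ideal.axioms(1)[OF Idl_ideal], of p q]
  by (simp add: poly_ring_def)

lemma Idl_mult:
  "p \<in> Idl\<^bsub>poly_ring K n\<^esub> S \<Longrightarrow> r \<in> carrier (poly_ring K n) \<Longrightarrow> r * p \<in> Idl\<^bsub>poly_ring K n\<^esub> S"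
  using ideal.I_l_closed[OF Idl_ideal, of p r] by (simp add: poly_ring_def)

lemma Idl_zero: "0 \<in> Idl\<^bsub>poly_ring K n\<^esub> S"
  using additive_subgroup.zero_closed[OF ideal.axioms(1)[OF Idl_ideal]]
  by (simp add: poly_ring_def)

lemma Idl_uminus: "p \<in> Idl\<^bsub>poly_ring K n\<^esub> S \<Longrightarrow> - p \<in> Idl\<^bsub>poly_ring K n\<^esub> S"
proof -
  assume "p \<in> Idl\<^bsub>poly_ring K n\<^esub> S"
  moreover have "- 1 \<in> carrier (poly_ring K n)" by (simp add: carrier_poly_ring)
  ultimately show ?thesis using Idl_mult[of p "- 1"] by simp
qed

lemma Idl_self: "S \<subseteq> Idl\<^bsub>poly_ring K n\<^esub> S"
  using S cring_poly_ring cring.axioms(1) ring.genideal_self by blast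

lemma Idl_least: "S' \<subseteq> Idl\<^bsub>poly_ring K n\<^esub> S \<Longrightarrow> Idl\<^bsub>poly_ring K n\<^esub> S' \<subseteq> Idl\<^bsub>poly_ring K n\<^esub> S"
  using Idl_ideal cring_poly_ring cring.axioms(1) ring.genideal_minimal by blast

end

lemma idealI_poly_ring:
  assumes "I \<subseteq> carrier (poly_ring K n)" "0 \<in> I"
    "\<And>p q. p \<in> I \<Longrightarrow> q \<in> I \<Longrightarrow> p + q \<in> I"
    "\<And>p r. p \<in> I \<Longrightarrow> r \<in> carrier (poly_ring K n) \<Longrightarrow> r * p \<in> I"
  shows "ideal I (poly_ring K n)"
proof -
  let ?R = "poly_ring K n"
  interpret cring ?R by (rule cring_poly_ring)
  have um: "- p \<in> I" if "p \<in> I" for p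
    using assms(4)[OF that, of "- 1"] by (simp add: carrier_poly_ring)
  show ?thesis
  proof (rule idealI)
    show "ring ?R" by (rule ring_axioms)
    show "subgroup I (add_monoid ?R)"
    proof (rule add.subgroupI)
      show "I \<subseteq> carrier ?R" by fact
      show "I \<noteq> {}" using assms(2) by blast
      show "\<ominus>\<^bsub>?R\<^esub> p \<in> I" if "p \<in> I" for p
      proof -
        have "\<ominus>\<^bsub>?R\<^esub> p = - p"
          using that um assms(1) by (intro minus_equality) (auto simp: poly_ring_def)
        then show ?thesis using um[OF that] by simp
      qed
      show "p \<oplus>\<^bsub>?R\<^esub> q \<in> I" if "p \<in> I" "q \<in> I" for p q
        using assms(3)[OF that] by (simp add: poly_ring_def)
    qed
    show "x \<otimes>\<^bsub>?R\<^esub> p \<in> I" if "p \<in> I" "x \<in> carrier ?R" for p x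
      using assms(4)[OF that] by (simp add: poly_ring_def)
    show "p \<otimes>\<^bsub>?R\<^esub> x \<in> I" if "p \<in> I" "x \<in> carrier ?R" for p x
      using assms(4)[OF that] by (simp add: poly_ring_def mult.commute)
  qed
qed

definition coeff_sum :: "(nat \<Rightarrow>\<^sub>0 nat) set \<Rightarrow> 'k::field mpoly \<Rightarrow> 'k" where
  "coeff_sum Q p = (\<Sum>t\<in>Poly_Mapping.keys p. if t \<in> Q then poly_mapping.lookup p t else 0)"

lemma coeff_sum_add: "coeff_sum Q (p + q) = coeff_sum Q p + coeff_sum Q q"
  unfolding coeff_sum_def
  by (rule setsum_keys_plus_distrib[where f = "\<lambda>t c. if t \<in> Q then c else 0"]) auto

lemma coeff_sum_single:
  "coeff_sum Q (Poly_Mapping.single t c) = (if t \<in> Q then c else 0)"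
  by (simp add: coeff_sum_def)

lemma coeff_sum_uminus: "coeff_sum Q (- p) = - coeff_sum Q p"
  using coeff_sum_add[of Q p "- p"] by (simp add: coeff_sum_def eq_neg_iff_add_eq_0 add.commute)

lemma coeff_sum_diff: "coeff_sum Q (p - q) = coeff_sum Q p - coeff_sum Q q"
  using coeff_sum_add[of Q p "- q"] by (simp add: coeff_sum_uminus)

text \<open>
  Multiplied by a term with exponent \<open>t\<close>, the binomial contributes the same coefficient with
  opposite signs at \<open>t + v\<^sup>+\<close> and \<open>t + v\<^sup>-\<close>, and \<open>Q\<close> contains both exponents or neither.
\<close>

lemma coeff_sum_mult_binomial:
  fixes K :: "'k::field itself"
  assumes "\<And>t. t + positive_part v \<in> Q \<longleftrightarrow> t + positive_part (- v) \<in> Q"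
  shows "coeff_sum Q (r * binomial_of K v) = 0"
proof (induction r rule: update_induct)
  case const
  then show ?case by (simp add: coeff_sum_def)
next
  case (update f a b)
  have "Poly_Mapping.update a b f = f + Poly_Mapping.single a b"
    using update(1) by (intro poly_mapping_eqI)
      (auto simp: lookup_update lookup_add lookup_single when_def in_keys_iff)
  then show ?case
    using update(3) assms
    by (simp add: distrib_right coeff_sum_add binomial_of_def monomial_def right_diff_distrib
        mult_single coeff_sum_diff coeff_sum_single)
qed

text \<open>
  A binomial lies in the ideal only if the generators connect \<open>u\<^sup>+\<close> to \<open>u\<^sup>-\<close> by moves
  \<open>t + v\<^sup>+ \<leftrightarrow> t + v\<^sup>-\<close>, so no set of exponents that is closed under the moves
  separates the two. The polynomials all of whose multiples have coefficient sum 0 over \<open>Q\<close> form an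
  ideal that contains the generators.
\<close>

lemma binomial_in_Idl_saturated:
  fixes K :: "'k::field itself"
  assumes V: "V \<subseteq> carrier_vec n"
    and sat: "\<And>v t. v \<in> V \<Longrightarrow> t + positive_part v \<in> Q \<longleftrightarrow> t + positive_part (- v) \<in> Q"
    and mem: "binomial_of K u \<in> Idl\<^bsub>poly_ring K n\<^esub> (binomial_of K ` V)"
  shows "positive_part u \<in> Q \<longleftrightarrow> positive_part (- u) \<in> Q"
proof -
  let ?R = "poly_ring K n"
  let ?J = "{p \<in> carrier ?R. \<forall>r. coeff_sum Q (r * p) = 0}"
  interpret cring ?R by (rule cring_poly_ring)
  have "ideal ?J ?R"
  proof (rule idealI_poly_ring)
    show "0 \<in> ?J" by (simp add: coeff_sum_def carrier_poly_ring)
    show "p + q \<in> ?J" if "p \<in> ?J" "q \<in> ?J" for p q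
      using that add.m_closed[of p q] by (simp add: distrib_left coeff_sum_add poly_ring_def)
    show "r * p \<in> ?J" if "p \<in> ?J" "r \<in> carrier ?R" for p r
      using that m_closed[of r p] by (simp add: mult.assoc[symmetric] mult_poly_ring)
  qed auto
  moreover have "binomial_of K ` V \<subseteq> ?J"
    using binomial_of_carrier V coeff_sum_mult_binomial[where Q = Q and K = K] sat by blast
  ultimately have "binomial_of K u \<in> ?J" using genideal_minimal mem by blast
  then have "coeff_sum Q (1 * binomial_of K u) = 0" by blast
  then show ?thesis
    by (simp add: binomial_of_def monomial_def coeff_sum_diff coeff_sum_single split: if_splits)
qed

section \<open>Binomials of a toric ideal\<close>

lemma carrier_mat_kernel: "u \<in> mat_kernel M \<Longrightarrow> u \<in> carrier_vec (dim_col M)"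
  by (simp add: mat_kernel_def)

lemma zero_mat_kernel: "0\<^sub>v (dim_col M) \<in> mat_kernel M"
  by (auto simp: mat_kernel_def)

lemma add_mat_kernel:
  assumes "u \<in> mat_kernel M" "v \<in> mat_kernel M"
  shows "u + v \<in> mat_kernel M"
  using assms mult_add_distrib_mat_vec[of M "dim_row M" "dim_col M" u v]
  by (auto simp: mat_kernel_def)

lemma uminus_mat_kernel:
  fixes M :: "int mat"
  assumes "u \<in> mat_kernel M"
  shows "- u \<in> mat_kernel M"
proof -
  have "- u = (- 1) \<cdot>\<^sub>v u" by auto
  then show ?thesis using mat_kernel_smult[of M "dim_row M" "dim_col M" u "- 1"] assms by auto
qed

lemma minus_mat_kernel:
  fixes M :: "int mat"
  assumes "u \<in> mat_kernel M" "v \<in> mat_kernel M"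
  shows "u - v \<in> mat_kernel M"
proof -
  have "u - v = u + - v"
    using assms by (intro minus_add_uminus_vec) (auto dest: carrier_mat_kernel)
  then show ?thesis using assms add_mat_kernel uminus_mat_kernel by metis
qed

lemma positively_gradedD:
  assumes "positively_graded M" "u \<in> mat_kernel M" "\<And>i. i < dim_col M \<Longrightarrow> 0 \<le> u $ i"
  shows "u = 0\<^sub>v (dim_col M)"
proof -
  have "u \<in> mat_kernel M \<inter> {u. \<forall>i<dim_vec u. 0 \<le> u $ i}"
    using assms(2,3) carrier_mat_kernel[OF assms(2)] by simp
  then show ?thesis using assms(1) unfolding positively_graded_def by blast
qed

lemma binomial_mat_kernel_carrier:
  "binomial_of K ` mat_kernel M \<subseteq> carrier (poly_ring K (dim_col M))"
  using binomial_image_carrier carrier_mat_kernel by blast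

text \<open>
  The exponents congruent to \<open>u\<^sup>+\<close> modulo the kernel are closed under the moves of the generators,
  so \<open>u\<^sup>-\<close> is one of them.
\<close>

lemma binomial_in_toric_ideal_iff:
  fixes K :: "'k::field itself"
  assumes u: "u \<in> carrier_vec (dim_col M)"
  shows "binomial_of K u \<in> toric_ideal K M \<longleftrightarrow> u \<in> mat_kernel M"
proof
  assume "u \<in> mat_kernel M"
  then show "binomial_of K u \<in> toric_ideal K M"
    unfolding toric_ideal_def using Idl_self[OF binomial_mat_kernel_carrier] by blast
next
  let ?n = "dim_col M"
  define Q where "Q = {t. \<exists>w\<in>mat_kernel M. \<forall>i<?n.
    int (poly_mapping.lookup t i) = int (poly_mapping.lookup (positive_part u) i) + w $ i}"
  have move: "t + positive_part (- v) \<in> Q"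
    if v: "v \<in> mat_kernel M" and t: "t + positive_part v \<in> Q" for v t
  proof -
    from t obtain w where w: "w \<in> mat_kernel M"
      and e: "\<forall>i<?n. int (poly_mapping.lookup (t + positive_part v) i)
          = int (poly_mapping.lookup (positive_part u) i) + w $ i"
      unfolding Q_def by blast
    have "int (poly_mapping.lookup (t + positive_part (- v)) i)
        = int (poly_mapping.lookup (positive_part u) i) + (w - v) $ i" if "i < ?n" for i
      using e[rule_format, OF that] that carrier_mat_kernel[OF v] carrier_mat_kernel[OF w]
      by (auto simp: lookup_add lookup_positive_part split: if_splits)
    then show ?thesis unfolding Q_def using minus_mat_kernel[OF w v] by blast
  qed
  have "t + positive_part v \<in> Q \<longleftrightarrow> t + positive_part (- v) \<in> Q" if "v \<in> mat_kernel M" for v t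
    using move[OF that] move[OF uminus_mat_kernel[OF that]] by auto
  moreover assume "binomial_of K u \<in> toric_ideal K M"
  moreover have "mat_kernel M \<subseteq> carrier_vec ?n" using carrier_mat_kernel by blast
  ultimately have "positive_part u \<in> Q \<longleftrightarrow> positive_part (- u) \<in> Q"
    unfolding toric_ideal_def by (intro binomial_in_Idl_saturated[where V = "mat_kernel M"])
  moreover have "positive_part u \<in> Q"
    unfolding Q_def using zero_mat_kernel[of M] by force
  ultimately obtain w where w: "w \<in> mat_kernel M"
    and e: "\<forall>i<?n. int (poly_mapping.lookup (positive_part (- u)) i)
          = int (poly_mapping.lookup (positive_part u) i) + w $ i"
    unfolding Q_def by blast
  have "u = - w"
  proof (rule eq_vecI)
    show "dim_vec u = dim_vec (- w)" using u carrier_mat_kernel[OF w] by simp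
    fix i assume "i < dim_vec (- w)"
    then show "u $ i = (- w) $ i"
      using e[rule_format, of i] u carrier_mat_kernel[OF w]
      by (auto simp: lookup_positive_part split: if_splits)
  qed
  then show "u \<in> mat_kernel M" using uminus_mat_kernel[OF w] by simp
qed

lemma toric_ideal_eqD:
  fixes K :: "'k::field itself"
  assumes "toric_ideal K M = toric_ideal K N" "dim_col M = dim_col N"
  shows "mat_kernel M = mat_kernel N"
proof -
  have "u \<in> mat_kernel M \<longleftrightarrow> u \<in> mat_kernel N" for u
  proof (cases "u \<in> carrier_vec (dim_col M)")
    case True
    then show ?thesis
      using binomial_in_toric_ideal_iff[of u M K] binomial_in_toric_ideal_iff[of u N K] assms by simp
  next
    case False
    then show ?thesis using carrier_mat_kernel[of u M] carrier_mat_kernel[of u N] assms(2) by auto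
  qed
  then show ?thesis by blast
qed

section \<open>The Graver basis generates\<close>

lemma monomial_divides_iff:
  fixes K :: "'k::field itself"
  assumes "Poly_Mapping.keys b \<subseteq> {..<n}"
  shows "monomial K a divides\<^bsub>poly_ring K n\<^esub> monomial K b \<longleftrightarrow>
    (\<forall>i. poly_mapping.lookup a i \<le> poly_mapping.lookup b i)"
proof
  assume "monomial K a divides\<^bsub>poly_ring K n\<^esub> monomial K b"
  then obtain c where "monomial K b = monomial K a * c"
    by (auto simp: factor_def mult_poly_ring)
  then have "b \<in> Poly_Mapping.keys (monomial K a * c)"
    by (metis keys_single insertI1 monomial_def zero_neq_one)
  then obtain d where "b = a + d"
    using keys_mult[of "monomial K a" c] by (auto simp: monomial_def)
  then show "\<forall>i. poly_mapping.lookup a i \<le> poly_mapping.lookup b i"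
    by (simp add: lookup_add)
next
  assume le: "\<forall>i. poly_mapping.lookup a i \<le> poly_mapping.lookup b i"
  have "b = a + (b - a)"
    using le by (intro poly_mapping_eqI) (simp add: lookup_add lookup_minus)
  moreover have "Poly_Mapping.keys (b - a) \<subseteq> {..<n}"
  proof
    fix i assume "i \<in> Poly_Mapping.keys (b - a)"
    then have "i \<in> Poly_Mapping.keys b"
      unfolding in_keys_iff lookup_minus by linarith
    then show "i \<in> {..<n}" using assms by blast
  qed
  ultimately show "monomial K a divides\<^bsub>poly_ring K n\<^esub> monomial K b"
    unfolding factor_def mult_poly_ring
    by (intro bexI[of _ "monomial K (b - a)"]) (simp_all add: monomial_mult monomial_carrier)
qed

lemma conformal_le_iff_divides:
  fixes K :: "'k::field itself"
  assumes "v \<in> carrier_vec n" "u \<in> carrier_vec n"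
  shows "monomial_pos K v divides\<^bsub>poly_ring K n\<^esub> monomial_pos K u \<and>
    monomial_neg K v divides\<^bsub>poly_ring K n\<^esub> monomial_neg K u \<longleftrightarrow> conformal_le v u"
proof -
  have "monomial_pos K v divides\<^bsub>poly_ring K n\<^esub> monomial_pos K u \<and>
      monomial_neg K v divides\<^bsub>poly_ring K n\<^esub> monomial_neg K u \<longleftrightarrow>
    (\<forall>i<n. nat (v $ i) \<le> nat (u $ i) \<and> nat (- (v $ i)) \<le> nat (- (u $ i)))"
    using assms keys_positive_part[of u] keys_positive_part[of "- u"]
    by (auto simp: monomial_divides_iff lookup_positive_part)
  also have "\<dots> \<longleftrightarrow> conformal_le v u"
  proof -
    have "nat a \<le> nat b \<and> nat (- a) \<le> nat (- b) \<longleftrightarrow> 0 \<le> a \<and> a \<le> b \<or> b \<le> a \<and> a \<le> 0" for a b :: int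
      by linarith
    then show ?thesis using assms by (simp add: conformal_le_def)
  qed
  finally show ?thesis .
qed

lemma graver_iff:
  "u \<in> graver K M \<longleftrightarrow> u \<in> mat_kernel M \<and> u \<noteq> 0\<^sub>v (dim_col M) \<and>
    (\<forall>v\<in>mat_kernel M. v \<noteq> 0\<^sub>v (dim_col M) \<longrightarrow> conformal_le v u \<longrightarrow> v = u)"
proof (cases "u \<in> carrier_vec (dim_col M)")
  case True
  have "v \<in> carrier_vec (dim_col M) \<and> v \<noteq> 0\<^sub>v (dim_col M) \<and> v \<noteq> u \<and>
      binomial_of K v \<in> toric_ideal K M \<and>
      monomial_pos K v divides\<^bsub>poly_ring K (dim_col M)\<^esub> monomial_pos K u \<and>
      monomial_neg K v divides\<^bsub>poly_ring K (dim_col M)\<^esub> monomial_neg K u \<longleftrightarrow>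
    v \<in> mat_kernel M \<and> v \<noteq> 0\<^sub>v (dim_col M) \<and> v \<noteq> u \<and> conformal_le v u" for v
    using binomial_in_toric_ideal_iff[of v M K] conformal_le_iff_divides[of v "dim_col M" u K]
      carrier_mat_kernel[of v M] True by blast
  then show ?thesis
    unfolding graver_def primitive_def mem_Collect_eq
    using binomial_in_toric_ideal_iff[OF True, of K] True by blast
next
  case False
  then show ?thesis by (auto simp: graver_def primitive_def dest: carrier_mat_kernel)
qed

lemma graver_subset_mat_kernel: "graver K M \<subseteq> mat_kernel M"
  by (auto simp: graver_iff)

lemma conformal_le_trans:
  assumes "conformal_le u v" "conformal_le v w" "dim_vec v = dim_vec w"
  shows "conformal_le u w"
  unfolding conformal_le_def
proof (intro allI impI)
  fix i assume "i < dim_vec w"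
  then show "0 \<le> u $ i \<and> u $ i \<le> w $ i \<or> w $ i \<le> u $ i \<and> u $ i \<le> 0"
    using assms(1,2)[unfolded conformal_le_def, rule_format, of i] assms(3) by linarith
qed

definition abs_sum :: "int vec \<Rightarrow> nat" where
  "abs_sum u = (\<Sum>i<dim_vec u. nat \<bar>u $ i\<bar>)"

lemma abs_sum_less:
  assumes "v \<in> carrier_vec n" "u \<in> carrier_vec n" "conformal_le v u" "v \<noteq> u"
  shows "abs_sum v < abs_sum u"
proof -
  obtain j where j: "j < n" "v $ j \<noteq> u $ j" using assms by (metis carrier_vecD eq_vecI)
  have *: "0 \<le> v $ i \<and> v $ i \<le> u $ i \<or> u $ i \<le> v $ i \<and> v $ i \<le> 0" if "i < n" for i
    using assms that by (auto simp: conformal_le_def)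
  have "(\<Sum>i<n. nat \<bar>v $ i\<bar>) < (\<Sum>i<n. nat \<bar>u $ i\<bar>)"
  proof (rule sum_strict_mono_ex1)
    show "\<forall>i\<in>{..<n}. nat \<bar>v $ i\<bar> \<le> nat \<bar>u $ i\<bar>"
    proof
      fix i assume "i \<in> {..<n}"
      then show "nat \<bar>v $ i\<bar> \<le> nat \<bar>u $ i\<bar>" using *[of i] by auto
    qed
    show "\<exists>i\<in>{..<n}. nat \<bar>v $ i\<bar> < nat \<bar>u $ i\<bar>"
    proof
      show "nat \<bar>v $ j\<bar> < nat \<bar>u $ j\<bar>" using *[OF j(1)] j(2) by linarith
    qed (use j in simp)
  qed simp
  then show ?thesis using assms by (simp add: abs_sum_def)
qed

text \<open>
  A nonzero kernel vector below \<open>v\<close> with least \<open>abs_sum\<close> is minimal in the conformal order.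
\<close>

lemma ex_graver_conformal_le:
  assumes "v \<in> mat_kernel M" "v \<noteq> 0\<^sub>v (dim_col M)"
  shows "\<exists>g\<in>graver K M. conformal_le g v"
proof -
  let ?P = "\<lambda>g. g \<in> mat_kernel M \<and> g \<noteq> 0\<^sub>v (dim_col M) \<and> conformal_le g v"
  have "?P v" using assms by (auto simp: conformal_le_def)
  then obtain g where g: "?P g" and least: "\<And>h. ?P h \<Longrightarrow> abs_sum g \<le> abs_sum h"
    using ex_has_least_nat[of ?P v abs_sum] by blast
  have "h = g" if "h \<in> mat_kernel M" "h \<noteq> 0\<^sub>v (dim_col M)" "conformal_le h g" for h
  proof (rule ccontr)
    assume "h \<noteq> g"
    then have "abs_sum h < abs_sum g"
      using abs_sum_less[OF carrier_mat_kernel[OF that(1)]] that(3) g carrier_mat_kernel[of g] by blast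
    moreover have "conformal_le h v"
      using conformal_le_trans[OF that(3)] g carrier_mat_kernel[of g] carrier_mat_kernel[OF assms(1)] by auto
    ultimately show False using least[of h] that by simp
  qed
  then have "g \<in> graver K M" using g by (simp add: graver_iff)
  then show ?thesis using g by blast
qed

lemma binomial_semiconformal_in_Idl:
  assumes S: "S \<subseteq> carrier (poly_ring K n)"
    and vw: "v \<in> carrier_vec n" "w \<in> carrier_vec n" "semiconformal v w"
    and mem: "binomial_of K v \<in> Idl\<^bsub>poly_ring K n\<^esub> S" "binomial_of K w \<in> Idl\<^bsub>poly_ring K n\<^esub> S"
  shows "binomial_of K (v + w) \<in> Idl\<^bsub>poly_ring K n\<^esub> S"
proof -
  have "Poly_Mapping.keys (positive_part (v + w) - positive_part v) \<subseteq> {..<n}"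
    "Poly_Mapping.keys (positive_part (- (v + w)) - positive_part (- w)) \<subseteq> {..<n}"
    using vw by (auto simp: in_keys_iff lookup_minus lookup_positive_part split: if_splits)
  then show ?thesis
    unfolding binomial_of_semiconformal[OF vw]
    by (intro Idl_add[OF S] Idl_mult[OF S] mem monomial_carrier)
qed

text \<open>
  Subtracting a Graver vector \<open>g\<close> below \<open>v\<close> leaves a smaller kernel vector that is still below
  \<open>v\<close>, and \<open>v = g + (v - g)\<close> is semiconformal. The bound \<open>g\<close> below \<open>v\<close> is kept in the statement in
  order to control later which Graver vectors are used.
\<close>

lemma binomial_in_Idl_conformal_graver:
  fixes K :: "'k::field itself"
  assumes "v \<in> mat_kernel M"
  shows "binomial_of K v \<in>
    Idl\<^bsub>poly_ring K (dim_col M)\<^esub> (binomial_of K ` {g \<in> graver K M. conformal_le g v})"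
  using assms
proof (induction "abs_sum v" arbitrary: v rule: less_induct)
  case less
  let ?n = "dim_col M" and ?G = "\<lambda>v. binomial_of K ` {g \<in> graver K M. conformal_le g v}"
  have S: "?G v \<subseteq> carrier (poly_ring K ?n)" for v
    using graver_subset_mat_kernel[of K M] carrier_mat_kernel[of _ M] by (intro binomial_image_carrier) blast
  have v: "v \<in> carrier_vec ?n" using less.prems by (rule carrier_mat_kernel)
  show ?case
  proof (cases "v = 0\<^sub>v ?n")
    case True
    then have "- v = v" by auto
    then have "binomial_of K v = 0" by (simp add: binomial_of_def)
    then show ?thesis using Idl_zero[OF S] by simp
  next
    case False
    then obtain g where gr: "g \<in> graver K M" and gv: "conformal_le g v"
      using ex_graver_conformal_le[OF less.prems] by blast
    define w where "w = v - g"
    have gk: "g \<in> mat_kernel M" and g0: "g \<noteq> 0\<^sub>v ?n" using gr by (auto simp: graver_iff)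
    have g: "g \<in> carrier_vec ?n" using gk carrier_mat_kernel by blast
    have wk: "w \<in> mat_kernel M" unfolding w_def using less.prems gk by (rule minus_mat_kernel)
    have w: "w \<in> carrier_vec ?n" using wk carrier_mat_kernel by blast
    have gw: "v = g + w" unfolding w_def using g v by auto
    have gv': "0 \<le> g $ i \<and> g $ i \<le> v $ i \<or> v $ i \<le> g $ i \<and> g $ i \<le> 0" if "i < ?n" for i
      using gv v that by (auto simp: conformal_le_def)
    have wv: "conformal_le w v"
      unfolding w_def conformal_le_def
    proof (intro allI impI)
      fix i assume "i < dim_vec v"
      then show "0 \<le> (v - g) $ i \<and> (v - g) $ i \<le> v $ i \<or> v $ i \<le> (v - g) $ i \<and> (v - g) $ i \<le> 0"
        using gv'[of i] g v by auto
    qed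
    have sc: "semiconformal g w"
      unfolding w_def semiconformal_def
    proof (intro allI impI)
      fix i assume "i < dim_vec g" "0 < g $ i"
      then show "0 \<le> (v - g) $ i" using gv'[of i] g v by auto
    qed
    have "w \<noteq> v"
    proof
      assume "w = v"
      have "g $ i = 0" if "i < ?n" for i
      proof -
        have "(v - g) $ i = v $ i" using \<open>w = v\<close> by (simp add: w_def)
        then show ?thesis using that g v by simp
      qed
      then have "g = 0\<^sub>v ?n" using g by (intro eq_vecI) auto
      then show False using g0 by blast
    qed
    then have "abs_sum w < abs_sum v" using abs_sum_less[OF w v wv] by blast
    then have "binomial_of K w \<in> Idl\<^bsub>poly_ring K ?n\<^esub> (?G w)" using wk by (rule less.hyps)
    moreover have "conformal_le h v" if "conformal_le h w" for h
      using conformal_le_trans[OF that wv] w v by simp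
    then have "?G w \<subseteq> ?G v" by (intro image_mono Collect_mono) simp
    then have "Idl\<^bsub>poly_ring K ?n\<^esub> (?G w) \<subseteq> Idl\<^bsub>poly_ring K ?n\<^esub> (?G v)"
      by (intro Idl_least[OF S] order_trans[OF _ Idl_self[OF S]])
    ultimately have "binomial_of K w \<in> Idl\<^bsub>poly_ring K ?n\<^esub> (?G v)" by (rule subsetD[rotated])
    moreover have "binomial_of K g \<in> ?G v" using gr gv by simp
    then have "binomial_of K g \<in> Idl\<^bsub>poly_ring K ?n\<^esub> (?G v)"
      by (rule subsetD[OF Idl_self[OF S]])
    ultimately have "binomial_of K (g + w) \<in> Idl\<^bsub>poly_ring K ?n\<^esub> (?G v)"
      using binomial_semiconformal_in_Idl[OF S[of v] g w sc] by simp
    then show ?thesis by (simp only: gw[symmetric])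
  qed
qed

lemma toric_ideal_eq_if_graver:
  fixes K :: "'k::field itself"
  assumes S: "S \<subseteq> toric_ideal K M"
    and "\<And>g. g \<in> graver K M \<Longrightarrow> binomial_of K g \<in> Idl\<^bsub>poly_ring K (dim_col M)\<^esub> S"
  shows "Idl\<^bsub>poly_ring K (dim_col M)\<^esub> S = toric_ideal K M"
proof
  let ?R = "poly_ring K (dim_col M)"
  have "toric_ideal K M \<subseteq> carrier ?R" unfolding toric_ideal_def
    using ideal.Icarr[OF Idl_ideal[OF binomial_mat_kernel_carrier]] by blast
  then have SC: "S \<subseteq> carrier ?R" using S by blast
  show "Idl\<^bsub>?R\<^esub> S \<subseteq> toric_ideal K M"
    using S Idl_least[OF binomial_mat_kernel_carrier] unfolding toric_ideal_def by blast
  have "binomial_of K v \<in> Idl\<^bsub>?R\<^esub> S" if "v \<in> mat_kernel M" for v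
  proof -
    have "Idl\<^bsub>?R\<^esub> (binomial_of K ` {g \<in> graver K M. conformal_le g v}) \<subseteq> Idl\<^bsub>?R\<^esub> S"
      using assms(2) by (intro Idl_least[OF SC]) blast
    then show ?thesis using binomial_in_Idl_conformal_graver[OF that] by blast
  qed
  then show "toric_ideal K M \<subseteq> Idl\<^bsub>?R\<^esub> S"
    unfolding toric_ideal_def by (intro Idl_least[OF SC]) blast
qed

text \<open>
  If \<open>u\<close> or \<open>- u\<close> were conformally below one of the summands \<open>v\<close>, \<open>w\<close> of a splitting of
  \<open>u\<close>, then \<open>v\<close> or \<open>w\<close> would have all its entries of one sign, which the positive grading excludes.
  So the Graver vectors below the summands avoid \<open>u\<close> and \<open>- u\<close>.
\<close>

lemma splits_generated:
  fixes K :: "'k::field itself"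
  assumes pg: "positively_graded M" and sp: "splits (mat_kernel M) u"
  shows "binomial_of K u \<in>
    Idl\<^bsub>poly_ring K (dim_col M)\<^esub> (binomial_of K ` {g \<in> graver K M. g \<noteq> u \<and> g \<noteq> - u})"
proof -
  let ?n = "dim_col M" and ?S = "binomial_of K ` {g \<in> graver K M. g \<noteq> u \<and> g \<noteq> - u}"
  have S: "?S \<subseteq> carrier (poly_ring K ?n)"
    using graver_subset_mat_kernel[of K M] carrier_mat_kernel[of _ M] by (intro binomial_image_carrier) blast
  obtain v w where vk: "v \<in> mat_kernel M" and wk: "w \<in> mat_kernel M" and uvw: "u = v + w"
    and nz: "v \<noteq> 0\<^sub>v (dim_vec u)" "w \<noteq> 0\<^sub>v (dim_vec u)" and sc: "semiconformal v w"
    using sp unfolding splits_def by blast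
  have v: "v \<in> carrier_vec ?n" and w: "w \<in> carrier_vec ?n"
    using vk wk carrier_mat_kernel by blast+
  then have u: "u \<in> carrier_vec ?n" using uvw by simp
  have v0: "v \<noteq> 0\<^sub>v ?n" and w0: "w \<noteq> 0\<^sub>v ?n" using nz u by auto
  have sc': "0 < v $ i \<Longrightarrow> 0 \<le> w $ i" if "i < ?n" for i
    using sc v that by (auto simp: semiconformal_def)
  have vanish: False if "\<And>i. i < ?n \<Longrightarrow> x $ i \<le> 0" "x \<in> mat_kernel M" "x \<noteq> 0\<^sub>v ?n" for x
  proof -
    have x: "x \<in> carrier_vec ?n" using that carrier_mat_kernel by blast
    have "- x = 0\<^sub>v ?n" using that x
      by (intro positively_gradedD[OF pg] uminus_mat_kernel) auto
    then have "x = 0\<^sub>v ?n" using x by (metis uminus_uminus_vec uminus_zero_vec)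
    then show False using that by blast
  qed
  have vanish': False if "\<And>i. i < ?n \<Longrightarrow> 0 \<le> x $ i" "x \<in> mat_kernel M" "x \<noteq> 0\<^sub>v ?n" for x
    using that positively_gradedD[OF pg] by blast
  have uv: "\<not> conformal_le u v"
  proof
    assume "conformal_le u v"
    then have *: "0 \<le> (v + w) $ i \<and> (v + w) $ i \<le> v $ i \<or>
        v $ i \<le> (v + w) $ i \<and> (v + w) $ i \<le> 0" if "i < ?n" for i
      using that v w uvw by (auto simp: conformal_le_def)
    have "0 \<le> w $ i" if "i < ?n" for i
      using *[OF that] sc'[OF that] that v w by (cases "0 < v $ i") auto
    then show False using vanish'[OF _ wk w0] by blast
  qed
  have nuv: "\<not> conformal_le (- u) v"
  proof
    assume "conformal_le (- u) v"
    then have *: "0 \<le> - (v + w) $ i \<and> - (v + w) $ i \<le> v $ i \<or>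
        v $ i \<le> - (v + w) $ i \<and> - (v + w) $ i \<le> 0" if "i < ?n" for i
      using that v w uvw by (auto simp: conformal_le_def)
    have "v $ i \<le> 0" if "i < ?n" for i
      using *[OF that] sc'[OF that] that v w by (cases "0 < v $ i") auto
    then show False using vanish[OF _ vk v0] by blast
  qed
  have uw: "\<not> conformal_le u w"
  proof
    assume "conformal_le u w"
    then have *: "0 \<le> (v + w) $ i \<and> (v + w) $ i \<le> w $ i \<or>
        w $ i \<le> (v + w) $ i \<and> (v + w) $ i \<le> 0" if "i < ?n" for i
      using that v w uvw by (auto simp: conformal_le_def)
    have "v $ i \<le> 0" if "i < ?n" for i
      using *[OF that] sc'[OF that] that v w by (cases "0 < v $ i") auto
    then show False using vanish[OF _ vk v0] by blast
  qed
  have nuw: "\<not> conformal_le (- u) w"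
  proof
    assume "conformal_le (- u) w"
    then have *: "0 \<le> - (v + w) $ i \<and> - (v + w) $ i \<le> w $ i \<or>
        w $ i \<le> - (v + w) $ i \<and> - (v + w) $ i \<le> 0" if "i < ?n" for i
      using that v w uvw by (auto simp: conformal_le_def)
    have "0 \<le> w $ i" if "i < ?n" for i
      using *[OF that] sc'[OF that] that v w by (cases "0 < v $ i") auto
    then show False using vanish'[OF _ wk w0] by blast
  qed
  have mem: "binomial_of K x \<in> Idl\<^bsub>poly_ring K ?n\<^esub> ?S"
    if "x \<in> mat_kernel M" "\<not> conformal_le u x" "\<not> conformal_le (- u) x" for x
  proof -
    have "binomial_of K ` {g \<in> graver K M. conformal_le g x} \<subseteq> ?S" using that by blast
    then have "Idl\<^bsub>poly_ring K ?n\<^esub> (binomial_of K ` {g \<in> graver K M. conformal_le g x})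
        \<subseteq> Idl\<^bsub>poly_ring K ?n\<^esub> ?S"
      using Idl_self[OF S] by (intro Idl_least[OF S]) blast
    then show ?thesis using binomial_in_Idl_conformal_graver[OF that(1)] by blast
  qed
  show ?thesis unfolding uvw
    using binomial_semiconformal_in_Idl[OF S v w sc mem mem] uv nuv uw nuw vk wk uvw by simp
qed

section \<open>Finiteness of the Graver basis\<close>

lemma ex_incseq_subseq_nat: "\<exists>r. strict_mono r \<and> incseq (f \<circ> r)" for f :: "nat \<Rightarrow> nat"
proof -
  obtain r where r: "strict_mono r" and m: "monoseq (\<lambda>n. f (r n))"
    using seq_monosub[of f] by blast
  show ?thesis
  proof (cases "incseq (\<lambda>n. f (r n))")
    case True
    then show ?thesis using r by (auto simp: comp_def)
  next
    case False
    then have d: "decseq (\<lambda>n. f (r n))" using m by (simp add: monoseq_iff)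
    obtain N where N: "\<And>n. f (r N) \<le> f (r n)"
      using ex_has_least_nat[of "\<lambda>_. True" 0 "\<lambda>n. f (r n)"] by blast
    have "f (r (n + N)) = f (r N)" for n
      using N[of "n + N"] d by (simp add: decseq_def order_antisym)
    then have "incseq (f \<circ> (\<lambda>n. r (n + N)))" by (simp add: incseq_def)
    moreover have "strict_mono (\<lambda>n. r (n + N))" using r by (simp add: strict_mono_def)
    ultimately show ?thesis by blast
  qed
qed

text \<open>
  Dickson's lemma for sequences: pass to a subsequence for one coordinate after the other.
\<close>

lemma ex_incseq_subseq_finite:
  fixes f :: "nat \<Rightarrow> nat \<Rightarrow> nat"
  shows "\<exists>r. strict_mono r \<and> (\<forall>i<d. incseq (\<lambda>k. f (r k) i))"
proof (induction d)
  case 0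
  show ?case using strict_mono_id by auto
next
  case (Suc d)
  then obtain r where r: "strict_mono r" "\<forall>i<d. incseq (\<lambda>k. f (r k) i)" by blast
  obtain q where q: "strict_mono q" "incseq ((\<lambda>k. f (r k) d) \<circ> q)"
    using ex_incseq_subseq_nat by blast
  have "incseq (\<lambda>k. f ((r \<circ> q) k) i)" if "i < Suc d" for i
  proof (cases "i = d")
    case True
    then show ?thesis using q(2) by (simp add: comp_def)
  next
    case False
    then have "incseq (\<lambda>k. f (r k) i)" using r(2) that by simp
    then show ?thesis using strict_mono_mono[OF q(1)] by (simp add: mono_def)
  qed
  then show ?case using strict_mono_o[OF r(1) q(1)] by blast
qed

text \<open>
  Among infinitely many Graver vectors, Dickson's lemma finds two that are comparable in the
  conformal order.
\<close>

lemma finite_graver: "finite (graver K M)"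
proof (rule ccontr)
  assume "infinite (graver K M)"
  then obtain u :: "nat \<Rightarrow> int vec" where u: "inj u" "range u \<subseteq> graver K M"
    using infinite_countable_subset by blast
  let ?n = "dim_col M"
  \<comment> \<open>The first half of the coordinates holds the positive part, the second half the negative part.\<close>
  define f where "f k i = (if i < ?n then nat (u k $ i) else nat (- (u k $ (i - ?n))))" for k i
  obtain r where r: "strict_mono r" "\<forall>i<2 * ?n. incseq (\<lambda>k. f (r k) i)"
    using ex_incseq_subseq_finite by blast
  have g: "u k \<in> graver K M" for k using u(2) by blast
  have d: "dim_vec (u k) = ?n" for k
    using g[of k] carrier_mat_kernel[of "u k" M] by (auto simp: graver_iff)
  have "conformal_le (u (r 0)) (u (r 1))"
    unfolding conformal_le_def
  proof (intro allI impI)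
    fix i assume "i < dim_vec (u (r 1))"
    then have i: "i < ?n" using d by simp
    have "f (r 0) i \<le> f (r 1) i" "f (r 0) (i + ?n) \<le> f (r 1) (i + ?n)"
      using r(2) i by (simp_all add: incseq_def)
    then show "0 \<le> u (r 0) $ i \<and> u (r 0) $ i \<le> u (r 1) $ i \<or>
        u (r 1) $ i \<le> u (r 0) $ i \<and> u (r 0) $ i \<le> 0"
      using i by (simp add: f_def) linarith
  qed
  then have "u (r 0) = u (r 1)"
    using g[of "r 0"] g[of "r 1"] by (simp add: graver_iff)
  then have "r 0 = r 1" using u(1) by (simp add: inj_eq)
  then show False using r(1) by (metis strict_mono_eq zero_neq_one)
qed

section \<open>Indispensable binomials and strong robustness\<close>

lemma keys_binomial_of:
  "Poly_Mapping.keys (binomial_of K u) =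
    (if positive_part u = positive_part (- u) then {} else {positive_part u, positive_part (- u)})"
  by (auto simp: binomial_of_def monomial_def in_keys_iff lookup_minus lookup_single when_def
      split: if_splits)

lemma positive_part_eq_uminus_iff:
  assumes "u \<in> carrier_vec n"
  shows "positive_part u = positive_part (- u) \<longleftrightarrow> u = 0\<^sub>v n"
proof
  assume e: "positive_part u = positive_part (- u)"
  have "u $ i = 0" if "i < n" for i
    using arg_cong[OF e, of "\<lambda>t. poly_mapping.lookup t i"] that assms
    by (auto simp: lookup_positive_part)
  then show "u = 0\<^sub>v n" using assms by (intro eq_vecI) auto
qed (auto simp: positive_part_def)

text \<open>
  The supports are compared instead of the coefficients, so the argument also covers
  characteristic 2, where a binomial equals its opposite.
\<close>

lemma binomial_of_eq_imp:
  assumes u: "u \<in> carrier_vec n" and v: "v \<in> carrier_vec n"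
    and eq: "binomial_of K u = binomial_of K v \<or> binomial_of K u = - binomial_of K v"
  shows "u = v \<or> u = - v"
proof -
  have k: "Poly_Mapping.keys (binomial_of K u) = Poly_Mapping.keys (binomial_of K v)"
    using eq by auto
  show ?thesis
  proof (cases "u = 0\<^sub>v n")
    case True
    then have "v = 0\<^sub>v n"
      using k positive_part_eq_uminus_iff[OF u] positive_part_eq_uminus_iff[OF v]
      by (auto simp: keys_binomial_of split: if_splits)
    then show ?thesis using True by simp
  next
    case False
    then have "v \<noteq> 0\<^sub>v n"
      using k positive_part_eq_uminus_iff[OF u] positive_part_eq_uminus_iff[OF v]
      by (auto simp: keys_binomial_of split: if_splits)
    then have "{positive_part u, positive_part (- u)} = {positive_part v, positive_part (- v)}"
      using False k positive_part_eq_uminus_iff[OF u] positive_part_eq_uminus_iff[OF v]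
      by (simp add: keys_binomial_of)
    then show ?thesis
      using positive_part_eq_iff[OF u v] positive_part_eq_iff[OF u, of "- v"] v
      by (auto simp: doubleton_eq_iff)
  qed
qed

lemma toric_ideal_subset_carrier: "toric_ideal K M \<subseteq> carrier (poly_ring K (dim_col M))"
  unfolding toric_ideal_def
  by (rule subsetI, rule ideal.Icarr[OF Idl_ideal[OF binomial_mat_kernel_carrier]])

lemma binomial_graver_subset_toric_ideal: "binomial_of K ` graver K M \<subseteq> toric_ideal K M"
  by (auto simp: graver_def primitive_def)

text \<open>
  A generator other than the binomials of \<open>u\<close> and \<open>- u\<close> that moves \<open>x^u\<^sup>+\<close> to a different
  monomial yields a splitting of \<open>u\<close>. If there is none, and if the binomial of \<open>u\<close> is missing, then
  \<open>{u\<^sup>+}\<close> is closed under all moves although it separates \<open>u\<^sup>+\<close> from \<open>u\<^sup>-\<close>.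
\<close>

lemma nonsplit_binomial_in_generators:
  fixes K :: "'k::field itself"
  assumes u: "u \<in> mat_kernel M" "u \<noteq> 0\<^sub>v (dim_col M)" and ns: "\<not> splits (mat_kernel M) u"
    and F: "F \<subseteq> binomial_of K ` carrier_vec (dim_col M)"
    and gen: "Idl\<^bsub>poly_ring K (dim_col M)\<^esub> F = toric_ideal K M"
  shows "binomial_of K u \<in> F \<or> - binomial_of K u \<in> F"
proof (rule ccontr)
  let ?n = "dim_col M"
  assume notin: "\<not> (binomial_of K u \<in> F \<or> - binomial_of K u \<in> F)"
  define V where "V = {v \<in> carrier_vec ?n. binomial_of K v \<in> F}"
  have FV: "F = binomial_of K ` V" using F unfolding V_def by blast
  have V: "V \<subseteq> carrier_vec ?n" unfolding V_def by blast
  have uc: "u \<in> carrier_vec ?n" using u carrier_mat_kernel by blast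
  have "F \<subseteq> toric_ideal K M"
    using Idl_self[OF binomial_image_carrier[OF V], of K] by (simp add: gen FV[symmetric])
  then have VL: "v \<in> mat_kernel M" if "v \<in> V" for v
    using that binomial_in_toric_ideal_iff[of v M K] unfolding V_def by blast
  have Vu: "v \<noteq> u \<and> - v \<noteq> u" if "v \<in> V" for v
  proof -
    have "binomial_of K v \<in> F" using that by (simp add: V_def)
    moreover have "binomial_of K u = - binomial_of K v" if "- v = u"
      unfolding that[symmetric] by (simp add: binomial_of_uminus)
    ultimately show ?thesis using notin by auto
  qed
  have key: "t + positive_part (- v) = positive_part u"
    if v: "v \<in> mat_kernel M" "v \<noteq> u" and t: "t + positive_part v = positive_part u" for v t
  proof (rule ccontr)
    assume ne: "t + positive_part (- v) \<noteq> positive_part u"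
    have vc: "v \<in> carrier_vec ?n" using v carrier_mat_kernel by blast
    have le: "nat (v $ i) \<le> nat (u $ i)" if "i < ?n" for i
      using arg_cong[OF t, of "\<lambda>t. poly_mapping.lookup t i"] that vc uc
      by (auto simp: lookup_add lookup_positive_part)
    have "v \<noteq> 0\<^sub>v ?n"
    proof
      assume "v = 0\<^sub>v ?n"
      then have e: "positive_part v = positive_part (- v)"
        using positive_part_eq_uminus_iff[OF vc] by blast
      show False using ne t unfolding e by blast
    qed
    moreover have "u - v \<noteq> 0\<^sub>v ?n"
    proof
      assume e: "u - v = 0\<^sub>v ?n"
      have "v $ i = u $ i" if "i < ?n" for i
      proof -
        have "(u - v) $ i = 0\<^sub>v ?n $ i" by (simp only: e)
        then show ?thesis using that uc vc by simp
      qed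
      then have "v = u" using uc vc by (intro eq_vecI) auto
      then show False using v by blast
    qed
    moreover have "u = v + (u - v)" using uc vc by (intro eq_vecI) auto
    moreover have "semiconformal v (u - v)"
      unfolding semiconformal_def
    proof (intro allI impI)
      fix i assume "i < dim_vec v" "0 < v $ i"
      then show "0 \<le> (u - v) $ i" using le[of i] uc vc by auto
    qed
    ultimately have "splits (mat_kernel M) u"
      unfolding splits_def carrier_vecD[OF uc] using v(1) minus_mat_kernel[OF u(1) v(1)] by blast
    then show False using ns by blast
  qed
  have "t + positive_part v \<in> {positive_part u} \<longleftrightarrow> t + positive_part (- v) \<in> {positive_part u}"
    if "v \<in> V" for v t
    using key[of v t] key[of "- v" t] Vu[OF that] VL[OF that] uminus_mat_kernel[of v M]
    unfolding singleton_iff uminus_uminus_vec by blast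
  moreover have "binomial_of K u \<in> Idl\<^bsub>poly_ring K ?n\<^esub> (binomial_of K ` V)"
    using gen FV binomial_in_toric_ideal_iff[OF uc, of K] u by simp
  ultimately have "positive_part (- u) = positive_part u"
    using binomial_in_Idl_saturated[OF V, of "{positive_part u}" K u] by simp
  then show False using positive_part_eq_uminus_iff[OF uc] u by simp
qed

lemma ex_minimal_generators:
  assumes "finite S" "Idl\<^bsub>poly_ring K (dim_col M)\<^esub> S = toric_ideal K M" "S \<subseteq> toric_ideal K M"
  shows "\<exists>F\<subseteq>S. minimal_generators K M F"
proof -
  let ?P = "\<lambda>F. F \<subseteq> S \<and> Idl\<^bsub>poly_ring K (dim_col M)\<^esub> F = toric_ideal K M"
  have "?P S" using assms by simp
  then obtain F where F: "?P F" and least: "\<And>F'. ?P F' \<Longrightarrow> card F \<le> card F'"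
    using ex_has_least_nat[of ?P S card] by blast
  have "Idl\<^bsub>poly_ring K (dim_col M)\<^esub> F' \<noteq> toric_ideal K M" if "F' \<subset> F" for F'
  proof
    assume "Idl\<^bsub>poly_ring K (dim_col M)\<^esub> F' = toric_ideal K M"
    then have "card F \<le> card F'" using least[of F'] that F by auto
    moreover have "card F' < card F"
      using that F assms(1) finite_subset psubset_card_mono by metis
    ultimately show False by simp
  qed
  then show ?thesis using F assms(3) unfolding minimal_generators_def by auto
qed

lemma split_graver_redundant:
  fixes K :: "'k::field itself"
  assumes pg: "positively_graded M" and sp: "splits (mat_kernel M) u"
  shows "Idl\<^bsub>poly_ring K (dim_col M)\<^esub> (binomial_of K ` {g \<in> graver K M. g \<noteq> u \<and> g \<noteq> - u})
    = toric_ideal K M" (is "Idl\<^bsub>?R\<^esub> ?S = _")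
proof (rule toric_ideal_eq_if_graver)
  show sub: "?S \<subseteq> toric_ideal K M" using binomial_graver_subset_toric_ideal[of K M] by auto
  then have S: "?S \<subseteq> carrier ?R" using toric_ideal_subset_carrier by (rule order_trans)
  have bu: "binomial_of K u \<in> Idl\<^bsub>?R\<^esub> ?S" using pg sp by (rule splits_generated)
  show "binomial_of K g \<in> Idl\<^bsub>?R\<^esub> ?S" if "g \<in> graver K M" for g
  proof -
    consider "g = u" | "g = - u" | "g \<noteq> u \<and> g \<noteq> - u" by blast
    then show ?thesis
    proof cases
      case 2
      then show ?thesis using Idl_uminus[OF S bu] by (simp add: binomial_of_uminus)
    next
      case 3
      then have "binomial_of K g \<in> ?S" using that by simp
      then show ?thesis by (rule subsetD[OF Idl_self[OF S]])
    qed (use bu in simp)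
  qed
qed

text \<open>
  Indispensability quantifies over all minimal systems of binomial generators, so if \<open>u\<close> splits or
  vanishes one must exhibit such a system that avoids the binomial of \<open>u\<close>. It is found inside the
  Graver basis, which is finite and generates the ideal even after the binomial of \<open>u\<close> and its
  opposite are removed.
\<close>

lemma indispensable_iff:
  fixes K :: "'k::field itself"
  assumes pg: "positively_graded M" and u: "u \<in> mat_kernel M"
  shows "u \<in> indispensable K M \<longleftrightarrow> u \<noteq> 0\<^sub>v (dim_col M) \<and> \<not> splits (mat_kernel M) u"
proof
  assume "u \<noteq> 0\<^sub>v (dim_col M) \<and> \<not> splits (mat_kernel M) u"
  then show "u \<in> indispensable K M"
    unfolding indispensable_def minimal_generators_def
    using nonsplit_binomial_in_generators[OF u] u by auto
next
  let ?S = "binomial_of K ` {g \<in> graver K M. g \<noteq> u \<and> g \<noteq> - u}"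
  assume ind: "u \<in> indispensable K M"
  have uc: "u \<in> carrier_vec (dim_col M)" using u by (rule carrier_mat_kernel)
  show "u \<noteq> 0\<^sub>v (dim_col M) \<and> \<not> splits (mat_kernel M) u"
  proof (rule ccontr)
    assume h: "\<not> (u \<noteq> 0\<^sub>v (dim_col M) \<and> \<not> splits (mat_kernel M) u)"
    have sub: "?S \<subseteq> toric_ideal K M" using binomial_graver_subset_toric_ideal[of K M] by auto
    have "Idl\<^bsub>poly_ring K (dim_col M)\<^esub> ?S = toric_ideal K M"
    proof (cases "u = 0\<^sub>v (dim_col M)")
      case True
      then have "- u = u" by auto
      then have "g \<noteq> u \<and> g \<noteq> - u" if "g \<in> graver K M" for g
        using that True by (auto simp: graver_iff)
      then have e: "{g \<in> graver K M. g \<noteq> u \<and> g \<noteq> - u} = graver K M" by auto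
      have S: "?S \<subseteq> carrier (poly_ring K (dim_col M))"
        using sub toric_ideal_subset_carrier by (rule order_trans)
      show ?thesis
      proof (rule toric_ideal_eq_if_graver[OF sub])
        fix g assume "g \<in> graver K M"
        then have "binomial_of K g \<in> ?S" by (simp add: e)
        then show "binomial_of K g \<in> Idl\<^bsub>poly_ring K (dim_col M)\<^esub> ?S"
          by (rule subsetD[OF Idl_self[OF S]])
      qed
    next
      case False
      then show ?thesis using h split_graver_redundant[OF pg] by blast
    qed
    moreover have "finite ?S" using finite_graver[of K M] by simp
    ultimately obtain F where F: "F \<subseteq> ?S" "minimal_generators K M F"
      using ex_minimal_generators[OF _ _ sub] by blast
    have gc: "g \<in> carrier_vec (dim_col M)" if "g \<in> graver K M" for g
      using that by (simp add: graver_def primitive_def)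
    then have "F \<subseteq> binomial_of K ` carrier_vec (dim_col M)" using F(1) by auto
    then have "binomial_of K u \<in> F \<or> - binomial_of K u \<in> F"
      using ind F(2) unfolding indispensable_def by blast
    then obtain g where g: "g \<in> graver K M" "g \<noteq> u" "g \<noteq> - u"
      "binomial_of K g = binomial_of K u \<or> binomial_of K g = - binomial_of K u"
      using F(1) by fastforce
    then show False using binomial_of_eq_imp[OF gc uc] by blast
  qed
qed

text \<open>
  The element is chosen from the set \<open>{b, - b}\<close>, which does not distinguish \<open>b\<close> from \<open>- b\<close>.
\<close>

lemma ex_sign_representatives:
  fixes B :: "'a::group_add set"
  shows "\<exists>F. sign_representatives F B"
proof -
  define c where "c b = (SOME x. x \<in> B \<and> x \<in> {b, - b})" for b :: 'a
  have c: "c b \<in> B" "c b = b \<or> c b = - b" if "b \<in> B" for b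
    using someI[of "\<lambda>x. x \<in> B \<and> x \<in> {b, - b}" b] that by (auto simp: c_def)
  have cm: "c (- b) = c b" for b by (simp add: c_def insert_commute)
  have "sign_representatives (c ` B) B"
    unfolding sign_representatives_def
  proof (intro conjI ballI)
    show "c ` B \<subseteq> B" using c by blast
    fix b assume b: "b \<in> B"
    show "\<exists>!f. f \<in> c ` B \<and> (f = b \<or> f = - b)"
    proof (rule ex1I[of _ "c b"])
      show "c b \<in> c ` B \<and> (c b = b \<or> c b = - b)" using b c by blast
      fix f assume f: "f \<in> c ` B \<and> (f = b \<or> f = - b)"
      then obtain a where a: "a \<in> B" "f = c a" by blast
      then have "f = a \<or> f = - a" using c by blast
      then have "a = b \<or> a = - b" using f by auto
      then show "f = c b" using a cm by auto
    qed
  qed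
  then show ?thesis by blast
qed

text \<open>
  A Graver vector that splits has a redundant binomial; one that does not split has its binomial,
  up to sign, in every system of binomial generators, so no element can be omitted.
\<close>

lemma strongly_robust_iff:
  fixes K :: "'k::field itself"
  assumes pg: "positively_graded M"
  shows "strongly_robust K M \<longleftrightarrow> (\<forall>u\<in>graver K M. \<not> splits (mat_kernel M) u)"
proof
  let ?R = "poly_ring K (dim_col M)" and ?B = "binomial_of K ` graver K M"
  have BC: "?B \<subseteq> carrier ?R"
    using binomial_graver_subset_toric_ideal toric_ideal_subset_carrier by (rule order_trans)
  {
    assume ns: "\<forall>u\<in>graver K M. \<not> splits (mat_kernel M) u"
    obtain F where F: "sign_representatives F ?B" using ex_sign_representatives by blast
    then have FB: "F \<subseteq> ?B" by (simp add: sign_representatives_def)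
    have Ftor: "F \<subseteq> toric_ideal K M"
      using FB binomial_graver_subset_toric_ideal by (rule order_trans)
    have FC: "F \<subseteq> carrier ?R" using FB BC by (rule order_trans)
    have gen: "Idl\<^bsub>?R\<^esub> F = toric_ideal K M"
    proof (rule toric_ideal_eq_if_graver[OF Ftor])
      fix g assume "g \<in> graver K M"
      then obtain f where f: "f \<in> F" "f = binomial_of K g \<or> f = - binomial_of K g"
        using F unfolding sign_representatives_def by blast
      have "f \<in> Idl\<^bsub>?R\<^esub> F" using f(1) by (rule subsetD[OF Idl_self[OF FC]])
      then show "binomial_of K g \<in> Idl\<^bsub>?R\<^esub> F" using f(2) Idl_uminus[OF FC, of f] by auto
    qed
    have "Idl\<^bsub>?R\<^esub> F' \<noteq> toric_ideal K M" if F': "F' \<subset> F" for F'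
    proof
      assume gen': "Idl\<^bsub>?R\<^esub> F' = toric_ideal K M"
      obtain f where f: "f \<in> F" "f \<notin> F'" using F' by blast
      then obtain u where u: "u \<in> graver K M" "f = binomial_of K u" using FB by blast
      have "F' \<subseteq> binomial_of K ` carrier_vec (dim_col M)"
        using F' FB by (auto simp: graver_def primitive_def)
      then have "f \<in> F' \<or> - f \<in> F'"
        using nonsplit_binomial_in_generators[of u M F' K] gen' u ns by (simp add: graver_iff)
      then have "- f \<in> F'" using f by blast
      moreover have "- f = f"
      proof -
        have "\<exists>!x. x \<in> F \<and> (x = f \<or> x = - f)"
          using F u unfolding sign_representatives_def by blast
        moreover have "- f \<in> F" using \<open>- f \<in> F'\<close> F' by blast
        ultimately show ?thesis using f(1) by blast
      qed
      ultimately show False using f by simp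
    qed
    then show "strongly_robust K M"
      unfolding strongly_robust_def minimal_generators_def using F Ftor gen by blast
  }
  assume "strongly_robust K M"
  then obtain F where F: "sign_representatives F ?B" and min: "minimal_generators K M F"
    unfolding strongly_robust_def by blast
  show "\<forall>u\<in>graver K M. \<not> splits (mat_kernel M) u"
  proof (intro ballI notI)
    fix u assume u: "u \<in> graver K M" and sp: "splits (mat_kernel M) u"
    obtain f where f: "f \<in> F" "f = binomial_of K u \<or> f = - binomial_of K u"
      using F u unfolding sign_representatives_def by blast
    have Ftor: "F - {f} \<subseteq> toric_ideal K M" using min by (auto simp: minimal_generators_def)
    then have FC: "F - {f} \<subseteq> carrier ?R"
      using toric_ideal_subset_carrier by (rule order_trans)
    have gc: "g \<in> carrier_vec (dim_col M)" if "g \<in> graver K M" for g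
      using that by (simp add: graver_def primitive_def)
    have mem: "binomial_of K g \<in> Idl\<^bsub>?R\<^esub> (F - {f})"
      if g: "g \<in> graver K M" "g \<noteq> u" "g \<noteq> - u" for g
    proof -
      obtain h where h: "h \<in> F" "h = binomial_of K g \<or> h = - binomial_of K g"
        using F g unfolding sign_representatives_def by blast
      have "h \<noteq> f"
      proof
        assume "h = f"
        then have "binomial_of K g = binomial_of K u \<or> binomial_of K g = - binomial_of K u"
          using h(2) f(2) unfolding \<open>h = f\<close> by (metis minus_minus)
        then show False using binomial_of_eq_imp[OF gc[OF g(1)] gc[OF u]] g by blast
      qed
      then have "h \<in> F - {f}" using h by blast
      then have "h \<in> Idl\<^bsub>?R\<^esub> (F - {f})" by (rule subsetD[OF Idl_self[OF FC]])
      then show ?thesis using h(2) Idl_uminus[OF FC, of h] by auto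
    qed
    have "Idl\<^bsub>?R\<^esub> (binomial_of K ` {g \<in> graver K M. g \<noteq> u \<and> g \<noteq> - u}) \<subseteq> Idl\<^bsub>?R\<^esub> (F - {f})"
      by (rule Idl_least[OF FC]) (use mem in auto)
    then have "toric_ideal K M \<subseteq> Idl\<^bsub>?R\<^esub> (F - {f})"
      by (simp only: split_graver_redundant[OF pg sp])
    moreover have "Idl\<^bsub>?R\<^esub> (F - {f}) \<subseteq> toric_ideal K M"
      unfolding toric_ideal_def
      by (rule Idl_least[OF binomial_mat_kernel_carrier]) (rule Ftor[unfolded toric_ideal_def])
    ultimately have "Idl\<^bsub>?R\<^esub> (F - {f}) = toric_ideal K M" by (rule subset_antisym[rotated])
    moreover have "F - {f} \<subset> F" using f by blast
    ultimately show False using min unfolding minimal_generators_def by blast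
  qed
qed

section \<open>Bouquets\<close>

lemma nth_disjoint_if_distinct_concat:
  assumes "distinct (concat xs)" "i < length xs" "j < length xs" "i \<noteq> j"
  shows "set (xs ! i) \<inter> set (xs ! j) = {}"
  using assms
proof (induction xs arbitrary: i j)
  case (Cons x xs)
  have d: "set x \<inter> set (xs ! k) = {}" if "k < length xs" for k
    using Cons.prems(1) that by fastforce
  show ?case
    using Cons.IH[of "i - 1" "j - 1"] Cons.prems d[of "i - 1"] d[of "j - 1"]
    by (cases i; cases j) auto
qed simp

lemma gale_row_eq_iff:
  assumes "i < dim_row G" "j < dim_row G"
  shows "gale_row G i = c \<cdot>\<^sub>v gale_row G j \<longleftrightarrow>
    (\<forall>l<dim_col G. rat_of_int (G $$ (i, l)) = c * rat_of_int (G $$ (j, l)))"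
  using assms by (auto simp: vec_eq_iff)

lemma bouquet_nonempty: "B \<in> bouquets G \<Longrightarrow> B \<noteq> {} \<and> B \<subseteq> {..<dim_row G}"
proof -
  assume "B \<in> bouquets G"
  then obtain x where x: "x < dim_row G" "B = (bouquet_edges G)\<^sup>* `` {x}"
    by (auto simp: bouquets_def elim: quotientE)
  have "(x, y) \<in> (bouquet_edges G)\<^sup>* \<Longrightarrow> y < dim_row G" for y
    by (induction rule: rtrancl_induct) (use x in \<open>auto simp: bouquet_edges_def\<close>)
  then show ?thesis using x by auto
qed

lemma in_some_bouquet: "j < dim_row G \<Longrightarrow> \<exists>B\<in>bouquets G. j \<in> B"
  unfolding bouquets_def by (intro bexI[of _ "(bouquet_edges G)\<^sup>* `` {j}"]) (auto intro: quotientI)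

text \<open>
  The bouquet is connected. Along each of its edges the Gale rows are related by a scalar that is
  not negative, and not zero because the entries in column \<open>l\<close> do not vanish.
\<close>

lemma non_mixed_same_sign:
  assumes B: "B \<in> bouquets G" and nm: "non_mixed_bouquet G B"
    and l: "l < dim_col G" and nz: "\<forall>j\<in>B. G $$ (j, l) \<noteq> 0"
    and ij: "i \<in> B" "j \<in> B"
  shows "sgn (G $$ (i, l)) = sgn (G $$ (j, l))"
proof -
  obtain x where x: "x < dim_row G" "B = (bouquet_edges G)\<^sup>* `` {x}"
    using B by (auto simp: bouquets_def elim: quotientE)
  have *: "sgn (G $$ (y, l)) = sgn (G $$ (x, l))" if "(x, y) \<in> (bouquet_edges G)\<^sup>*" for y
    using that
  proof (induction rule: rtrancl_induct)
    case (step y z)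
    have yz: "y \<in> B" "z \<in> B" using step(1,2) x by auto
    have lt: "y < dim_row G" "z < dim_row G" using step(2) by (auto simp: bouquet_edges_def)
    obtain c where c: "gale_row G y = c \<cdot>\<^sub>v gale_row G z"
      using step(2) by (auto simp: bouquet_edges_def)
    have "\<not> c < 0"
      using nm step(2) yz c unfolding non_mixed_bouquet_def mixed_bouquet_def by blast
    moreover have e: "rat_of_int (G $$ (y, l)) = c * rat_of_int (G $$ (z, l))"
      using c gale_row_eq_iff[OF lt] l by blast
    moreover have "G $$ (y, l) \<noteq> 0" using nz yz by blast
    ultimately have "c > 0" by (cases "c = 0") auto
    then have "sgn (rat_of_int (G $$ (y, l))) = sgn (rat_of_int (G $$ (z, l)))"
      using e by (simp add: sgn_mult)
    then have "sgn (G $$ (y, l)) = sgn (G $$ (z, l))"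
      by (simp add: sgn_if split: if_splits)
    then show ?case using step.IH by simp
  qed simp
  have "(x, i) \<in> (bouquet_edges G)\<^sup>*" "(x, j) \<in> (bouquet_edges G)\<^sup>*" using ij x by auto
  then show ?thesis using *[of i] *[of j] by metis
qed

lemma bouquet_vector_nonzero:
  assumes "bouquet_vector G Bl c" "j \<in> set Bl"
  shows "c $ j \<noteq> 0"
proof (cases "free_bouquet G (set Bl)")
  case True
  then have "\<forall>j\<in>set Bl. c $ j \<noteq> 0"
    using bouquet_vector_def[THEN iffD1, OF assms(1), THEN conjunct2, THEN conjunct2]
    unfolding if_P[OF True] by blast
  then show ?thesis using assms(2) by blast
next
  case False
  then obtain l where l: "\<forall>j\<in>set Bl. G $$ (j, l) \<noteq> 0"
    "\<forall>j\<in>set Bl. c $ j =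
      sgn (G $$ (hd Bl, l)) * (G $$ (j, l) div Gcd ((\<lambda>i. G $$ (i, l)) ` set Bl))"
    using bouquet_vector_def[THEN iffD1, OF assms(1), THEN conjunct2, THEN conjunct2]
    unfolding if_not_P[OF False] by blast
  have "hd Bl \<in> set Bl" using assms(2) by (cases Bl) auto
  then have "sgn (G $$ (hd Bl, l)) \<noteq> 0" using l(1) by (simp add: sgn_eq_0_iff)
  moreover have "Gcd ((\<lambda>i. G $$ (i, l)) ` set Bl) dvd G $$ (j, l)"
    using assms(2) by (intro Gcd_dvd) simp
  then have "G $$ (j, l) div Gcd ((\<lambda>i. G $$ (i, l)) ` set Bl) \<noteq> 0"
    using l(1) assms(2) by (simp add: dvd_div_eq_0_iff)
  ultimately show ?thesis using l(2)[rule_format, OF assms(2)] by (simp only: mult_eq_0_iff simp_thms)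
qed

lemma bouquet_vector_pos:
  assumes c: "bouquet_vector G Bl c" and j: "j \<in> set Bl"
    and B: "set Bl \<in> bouquets G" and nm: "non_mixed_bouquet G (set Bl)"
  shows "0 < c $ j"
proof -
  have nf: "\<not> free_bouquet G (set Bl)" using nm by (simp add: non_mixed_bouquet_def)
  then obtain l where l: "l < dim_col G" "\<forall>j\<in>set Bl. G $$ (j, l) \<noteq> 0"
    "\<forall>j\<in>set Bl. c $ j =
      sgn (G $$ (hd Bl, l)) * (G $$ (j, l) div Gcd ((\<lambda>i. G $$ (i, l)) ` set Bl))"
    using bouquet_vector_def[THEN iffD1, OF c, THEN conjunct2, THEN conjunct2]
    unfolding if_not_P[OF nf] by blast
  let ?d = "Gcd ((\<lambda>i. G $$ (i, l)) ` set Bl)"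
  have hd: "hd Bl \<in> set Bl" using j by (cases Bl) auto
  have s: "sgn (G $$ (hd Bl, l)) = sgn (G $$ (j, l))"
    using non_mixed_same_sign[OF B nm l(1,2) hd j] .
  have "?d dvd G $$ (j, l)" using j by (intro Gcd_dvd) simp
  moreover have "0 \<le> ?d" by simp
  moreover have "G $$ (j, l) \<noteq> 0" using l(2) j by blast
  ultimately obtain k where k: "G $$ (j, l) = ?d * k" "0 < ?d" "k \<noteq> 0"
    by (metis dvdE less_le mult_zero_left mult_zero_right)
  have "G $$ (j, l) div ?d = k" using k by (metis less_irrefl nonzero_mult_div_cancel_left)
  moreover have "sgn (G $$ (j, l)) = sgn k" using k by (metis mult_1 sgn_mult sgn_pos)
  ultimately have "c $ j = sgn k * k" using l(3)[rule_format, OF j] by (simp only: s)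
  then show ?thesis using k(3) by (simp add: sgn_if)
qed

text \<open>
  The vectors of different bouquets have disjoint supports, so a single column of \<open>C\<close>
  contributes to each coordinate.
\<close>

lemma bouquet_map_nth:
  assumes bd: "bouquet_decomposition A G Bs C" and u: "u \<in> carrier_vec (length Bs)"
    and i: "i < length Bs" "j \<in> set (Bs ! i)"
  shows "(C *\<^sub>v u) $ j = C $$ (j, i) * u $ i"
proof -
  have C: "C \<in> carrier_mat (dim_col A) (length Bs)" and dc: "distinct (concat Bs)"
    and g: "dim_row G = dim_col A" and bv: "\<And>k. k < length Bs \<Longrightarrow> bouquet_vector G (Bs ! k) (col C k)"
    and B: "set (Bs ! i) \<in> bouquets G"
    using bd i by (auto simp: bouquet_decomposition_def gale_transform_def)
  have j: "j < dim_col A" using bouquet_nonempty[OF B] i g by auto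
  have z: "C $$ (j, k) = 0" if "k < length Bs" "k \<noteq> i" for k
  proof -
    have "j \<notin> set (Bs ! k)"
      using nth_disjoint_if_distinct_concat[OF dc that(1) i(1) that(2)] i(2) by blast
    then have "col C k $ j = 0"
      using bouquet_vector_def[THEN iffD1, OF bv[OF that(1)], THEN conjunct2, THEN conjunct1] j g by simp
    then show ?thesis using C j that by simp
  qed
  have "(C *\<^sub>v u) $ j = (\<Sum>k = 0..<length Bs. C $$ (j, k) * u $ k)"
    using C j u by (simp add: scalar_prod_def)
  also have "\<dots> = (\<Sum>k = 0..<length Bs. if k = i then C $$ (j, i) * u $ i else 0)"
    using z by (intro sum.cong) auto
  finally show ?thesis using i(1) by simp
qed

lemma kernel_zero_on_free:
  assumes "gale_transform A G" "x \<in> mat_kernel A" "free_bouquet G B" "j \<in> B" "j < dim_row G"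
  shows "x $ j = 0"
proof -
  obtain y where "y \<in> carrier_vec (dim_col G)" "x = G *\<^sub>v y"
    using assms(1,2) unfolding gale_transform_def bij_betw_def by blast
  moreover have "row G j = 0\<^sub>v (dim_col G)"
    using assms(3,4) by (simp add: free_bouquet_def free_index_def)
  ultimately show ?thesis using assms(5) by simp
qed

lemma simple_no_edges:
  assumes "\<forall>B\<in>bouquets G. is_singleton B"
  shows "bouquet_edges G = {}"
proof (rule ccontr)
  assume "bouquet_edges G \<noteq> {}"
  then obtain i j where ij: "(i, j) \<in> bouquet_edges G" by auto
  then have "i < dim_row G" "i \<noteq> j" by (auto simp: bouquet_edges_def)
  then have "(bouquet_edges G)\<^sup>* `` {i} \<in> bouquets G"
    unfolding bouquets_def by (intro quotientI) simp
  then have "is_singleton ((bouquet_edges G)\<^sup>* `` {i})" using assms by blast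
  moreover have "i \<in> (bouquet_edges G)\<^sup>* `` {i}" "j \<in> (bouquet_edges G)\<^sup>* `` {i}" using ij by auto
  ultimately show False using \<open>i \<noteq> j\<close> by (metis is_singletonE singletonD)
qed

section \<open>The matrix \<open>\<Lambda>(T)_\<omega>\<close> and its kernel\<close>

text \<open>
  The columns of \<open>\<Lambda>(T)_\<omega>\<close> are numbered by \<open>j < s + card ({..<s} - \<omega>)\<close>: first come those of the
  \<open>s\<close> variables, then the second copies that survive the deletion, enumerated increasingly by
  \<open>pick\<close>. The source of \<open>j\<close> is the variable whose copy stands in column \<open>j\<close>, and the sign is the
  one with which the copy enters a kernel vector.
\<close>

definition lawrence_source :: "nat \<Rightarrow> nat set \<Rightarrow> nat \<Rightarrow> nat" where
  "lawrence_source s \<omega> j = (if j < s then j else pick ({..<s} - \<omega>) (j - s))"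

definition lawrence_sign :: "nat \<Rightarrow> nat \<Rightarrow> int" where
  "lawrence_sign s j = (if j < s then 1 else - 1)"

text \<open>
  The matrix of the map that sends \<open>u\<close> to \<open>u\<close> followed by the entries of \<open>- u\<close> outside \<open>\<omega>\<close>.
\<close>

definition lawrence_embedding :: "nat \<Rightarrow> nat set \<Rightarrow> int mat" where
  "lawrence_embedding s \<omega> = mat (s + card ({..<s} - \<omega>)) s
    (\<lambda>(j, i). if lawrence_source s \<omega> j = i then lawrence_sign s j else 0)"

text \<open>
  The columns with source \<open>i\<close>. They will be the elements of the \<open>i\<close>-th bouquet, and \<open>i\<close> comes
  first because the head of the list fixes the sign of the bouquet vector.
\<close>

definition lawrence_copies :: "nat \<Rightarrow> nat set \<Rightarrow> nat \<Rightarrow> nat list" where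
  "lawrence_copies s \<omega> i =
    (if i \<in> \<omega> then [i] else [i, s + card {a \<in> {..<s} - \<omega>. a < i}])"

text \<open>
  Rows (\<open>a = m\<close>) and columns (\<open>a = s\<close>) of the Lawrence lifting are deleted by the same pattern:
  nothing among the first \<open>a\<close>, and the shift of \<open>\<omega>\<close> among the last \<open>s\<close>.
\<close>

lemma pick_shifted:
  assumes "\<omega> \<subseteq> {..<s}" "k < a + card ({..<s} - \<omega>)"
  shows "pick ({..<a + s} - (\<lambda>i. a + i) ` \<omega>) k =
    (if k < a then k else a + pick ({..<s} - \<omega>) (k - a))"
proof -
  let ?J = "{..<s} - \<omega>" and ?I = "{..<a + s} - (\<lambda>i. a + i) ` \<omega>"
  define x where "x = (if k < a then k else a + pick ?J (k - a))"
  have "x \<in> ?I \<and> card {y \<in> ?I. y < x} = k"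
  proof (cases "k < a")
    case True
    have "{y \<in> ?I. y < k} = {..<k}" using True by auto
    then show ?thesis using True by (auto simp: x_def)
  next
    case False
    define l where "l = k - a"
    have l: "l < card ?J" "k = a + l" using False assms(2) by (auto simp: l_def)
    have p: "pick ?J l \<in> ?J" using l(1) by (rule pick_in_set_le)
    have x: "x = a + pick ?J l" using False by (simp add: x_def l_def)
    have "{y \<in> ?I. y < x} = {..<a} \<union> (\<lambda>i. a + i) ` {y \<in> ?J. y < pick ?J l}"
    proof (rule Set.set_eqI)
      fix y
      show "y \<in> {y \<in> ?I. y < x} \<longleftrightarrow> y \<in> {..<a} \<union> (\<lambda>i. a + i) ` {y \<in> ?J. y < pick ?J l}"
      proof (cases "y < a")
        case True
        then show ?thesis using x by auto
      next
        case False
        then obtain z where "y = a + z" using le_Suc_ex linorder_not_less by blast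
        then show ?thesis using x p by auto
      qed
    qed
    also have "card \<dots> = a + card {y \<in> ?J. y < pick ?J l}"
      by (subst card_Un_disjoint) (auto simp: card_image)
    also have "\<dots> = k" using card_pick_le[OF l(1)] l(2) by simp
    finally show ?thesis using p x by auto
  qed
  then have "pick ?I k = x" using pick_card_in_set by metis
  then show ?thesis by (simp add: x_def)
qed

lemma card_shifted:
  assumes "\<omega> \<subseteq> {..<s}"
  shows "card {i. i < a + s \<and> i \<in> {..<a + s} - (\<lambda>i. a + i) ` \<omega>} = a + card ({..<s} - \<omega>)"
proof -
  have "{i. i < a + s \<and> i \<in> {..<a + s} - (\<lambda>i. a + i) ` \<omega>} =
    {..<a} \<union> (\<lambda>i. a + i) ` ({..<s} - \<omega>)"
  proof (rule Set.set_eqI)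
    fix y
    show "y \<in> {i. i < a + s \<and> i \<in> {..<a + s} - (\<lambda>i. a + i) ` \<omega>} \<longleftrightarrow>
      y \<in> {..<a} \<union> (\<lambda>i. a + i) ` ({..<s} - \<omega>)"
    proof (cases "y < a")
      case False
      then obtain z where "y = a + z" using le_Suc_ex linorder_not_less by blast
      then show ?thesis by auto
    qed auto
  qed
  also have "card \<dots> = a + card ({..<s} - \<omega>)"
    by (subst card_Un_disjoint) (auto simp: card_image)
  finally show ?thesis .
qed

lemma sum_upt_add: "(\<Sum>j = 0..<a + b. f j) = (\<Sum>j = 0..<a. f j) + (\<Sum>l = 0..<b. f (a + l))"
  for f :: "nat \<Rightarrow> int"
  by (induction b) simp_all

context
  fixes s :: nat and \<omega> :: "nat set"
begin

private abbreviation (input) "r \<equiv> card ({..<s} - \<omega>)"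
private abbreviation (input) "E \<equiv> lawrence_embedding s \<omega>"
private abbreviation (input) "src \<equiv> lawrence_source s \<omega>"
private abbreviation (input) "J \<equiv> {..<s} - \<omega>"

declare index_mult_mat_vec [simp del]

lemma lawrence_source_less: "j < s + r \<Longrightarrow> src j < s"
  using pick_in_set_le[of "j - s" J] by (auto simp: lawrence_source_def)

lemma lawrence_embedding_carrier: "E \<in> carrier_mat (s + r) s"
  by (simp add: lawrence_embedding_def)

private lemmas Ec = lawrence_embedding_carrier

lemma lawrence_embedding_index:
  "j < s + r \<Longrightarrow> i < s \<Longrightarrow> E $$ (j, i) = (if src j = i then lawrence_sign s j else 0)"
  by (simp add: lawrence_embedding_def)

lemma lawrence_embedding_nth:
  assumes "u \<in> carrier_vec s" "j < s + r"
  shows "(E *\<^sub>v u) $ j = lawrence_sign s j * u $ src j"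
proof -
  have "(E *\<^sub>v u) $ j = (\<Sum>i = 0..<s. E $$ (j, i) * u $ i)"
    using assms lawrence_embedding_carrier by (simp add: index_mult_mat_vec scalar_prod_def)
  also have "\<dots> = (\<Sum>i = 0..<s. if i = src j then lawrence_sign s j * u $ src j else 0)"
    using assms(2) by (intro sum.cong) (auto simp: lawrence_embedding_index)
  finally show ?thesis using lawrence_source_less[OF assms(2)] by simp
qed

lemma lawrence_embedding_nth_less: "u \<in> carrier_vec s \<Longrightarrow> i < s \<Longrightarrow> (E *\<^sub>v u) $ i = u $ i"
  by (simp add: lawrence_embedding_nth lawrence_sign_def lawrence_source_def)

lemma lawrence_copies_set:
  assumes i: "i < s"
  shows "set (lawrence_copies s \<omega> i) = {j. j < s + r \<and> src j = i}"
proof -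
  let ?c = "card {a \<in> J. a < i}"
  have n: "j = i \<or> (i \<notin> \<omega> \<and> j = s + ?c)" if j: "j < s + r" "src j = i" for j
  proof (cases "j < s")
    case True
    then show ?thesis using j by (simp add: lawrence_source_def)
  next
    case False
    then have "pick J (j - s) = i" "j - s < r" using j by (auto simp: lawrence_source_def)
    then have "i \<in> J" "?c = j - s"
      using pick_in_set_le[of "j - s" J] card_pick_le[of "j - s" J] by auto
    then show ?thesis using False by auto
  qed
  moreover have "s + ?c < s + r \<and> src (s + ?c) = i" if "i \<notin> \<omega>"
  proof -
    have "i \<in> J" using i that by simp
    then have "?c < r" by (intro psubset_card_mono) auto
    then show ?thesis using \<open>i \<in> J\<close> pick_card_in_set[of i J] by (simp add: lawrence_source_def)
  qed
  moreover have "i < s + r" "src i = i" using i by (auto simp: lawrence_source_def)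
  ultimately show ?thesis by (auto simp: lawrence_copies_def)
qed

lemma lawrence_embedding_inj: "inj_on (\<lambda>u. E *\<^sub>v u) (carrier_vec s)"
proof (rule inj_onI)
  fix u v assume u: "u \<in> carrier_vec s" and v: "v \<in> carrier_vec s" and e: "E *\<^sub>v u = E *\<^sub>v v"
  show "u = v"
  proof (rule eq_vecI)
    fix i assume "i < dim_vec v"
    then have i: "i < s" using v by simp
    show "u $ i = v $ i"
      using lawrence_embedding_nth_less[OF u i] lawrence_embedding_nth_less[OF v i]
      by (simp add: e)
  qed (use u v in simp)
qed

lemma lawrence_embedding_eq_zero_iff:
  "u \<in> carrier_vec s \<Longrightarrow> E *\<^sub>v u = 0\<^sub>v (s + r) \<longleftrightarrow> u = 0\<^sub>v s"
proof -
  assume u: "u \<in> carrier_vec s"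
  have "E *\<^sub>v 0\<^sub>v s = 0\<^sub>v (s + r)"
    using Ec by (intro eq_vecI) (auto simp: lawrence_embedding_nth lawrence_source_less)
  then show ?thesis using inj_onD[OF lawrence_embedding_inj _ u zero_carrier_vec] by metis
qed

lemma lawrence_embedding_conformal_le:
  assumes "u \<in> carrier_vec s" "v \<in> carrier_vec s"
  shows "conformal_le (E *\<^sub>v v) (E *\<^sub>v u) \<longleftrightarrow> conformal_le v u"
proof
  assume h: "conformal_le (E *\<^sub>v v) (E *\<^sub>v u)"
  show "conformal_le v u"
    unfolding conformal_le_def
  proof (intro allI impI)
    fix i assume "i < dim_vec u"
    then have i: "i < s" using assms by simp
    then show "0 \<le> v $ i \<and> v $ i \<le> u $ i \<or> u $ i \<le> v $ i \<and> v $ i \<le> 0"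
      using h[unfolded conformal_le_def, rule_format, of i] Ec assms
      by (simp add: lawrence_embedding_nth_less)
  qed
next
  assume h: "conformal_le v u"
  show "conformal_le (E *\<^sub>v v) (E *\<^sub>v u)"
    unfolding conformal_le_def
  proof (intro allI impI)
    fix j assume "j < dim_vec (E *\<^sub>v u)"
    then have j: "j < s + r" using Ec by simp
    show "0 \<le> (E *\<^sub>v v) $ j \<and> (E *\<^sub>v v) $ j \<le> (E *\<^sub>v u) $ j \<or>
        (E *\<^sub>v u) $ j \<le> (E *\<^sub>v v) $ j \<and> (E *\<^sub>v v) $ j \<le> 0"
      using h[unfolded conformal_le_def, rule_format, of "src j"] assms lawrence_source_less[OF j]
        lawrence_embedding_nth[OF _ j] by (auto simp: lawrence_sign_def)
  qed
qed

context
  fixes T :: "int mat" and m :: nat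
  assumes T: "T \<in> carrier_mat m s" and \<omega>: "\<omega> \<subseteq> {..<s}"
begin

private abbreviation (input) "\<Lambda> \<equiv> lawrence_omega T \<omega>"

lemma lawrence_omega_carrier: "\<Lambda> \<in> carrier_mat (m + r) (s + r)"
  and lawrence_omega_index:
    "i < m + r \<Longrightarrow> j < s + r \<Longrightarrow> \<Lambda> $$ (i, j) =
      (if i < m then if j < s then T $$ (i, j) else 0
       else if j < s then of_bool (j = pick J (i - m)) else of_bool (j - s = i - m))"
proof -
  have d: "dim_row (lawrence T) = m + s" "dim_col (lawrence T) = s + s"
    using T by (auto simp: lawrence_def)
  have s2: "2 * dim_col T = s + s" "dim_col T = s" "dim_row T = m" using T by auto
  show "\<Lambda> \<in> carrier_mat (m + r) (s + r)"
    using card_shifted[OF \<omega>]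
    unfolding lawrence_omega_def s2 mult_2
    by (intro carrier_matI) (simp_all only: dim_submatrix d)
  show "\<Lambda> $$ (i, j) =
      (if i < m then if j < s then T $$ (i, j) else 0
       else if j < s then of_bool (j = pick J (i - m)) else of_bool (j - s = i - m))"
    if i: "i < m + r" and j: "j < s + r"
  proof -
    let ?i = "if i < m then i else m + pick J (i - m)"
    let ?j = "if j < s then j else s + pick J (j - s)"
    have p: "pick J (i - m) < s" if "\<not> i < m"
      using pick_in_set_le[of "i - m" J] i that by auto
    have q: "pick J (j - s) < s" if "\<not> j < s"
      using pick_in_set_le[of "j - s" J] j that by auto
    have inj: "pick J (i - m) = pick J (j - s) \<longleftrightarrow> j - s = i - m" if "\<not> i < m" "\<not> j < s"
    proof -
      have "i - m < r" "j - s < r" using i j that by auto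
      then show ?thesis by (metis card_pick_le)
    qed
    have "\<Lambda> $$ (i, j) = lawrence T $$ (?i, ?j)"
      unfolding lawrence_omega_def s2 mult_2
      using i j by (subst submatrix_index) (simp_all only: d card_shifted[OF \<omega>] pick_shifted[OF \<omega>])
    also have "\<dots> = (if i < m then if j < s then T $$ (i, j) else 0
       else if j < s then of_bool (j = pick J (i - m)) else of_bool (j - s = i - m))"
      using T p q inj unfolding lawrence_def by (auto simp: index_mat_four_block)
    finally show ?thesis .
  qed
qed

private lemmas Lc = lawrence_omega_carrier

lemma lawrence_mult_nth:
  assumes x: "x \<in> carrier_vec (s + r)" and i: "i < m + r"
  shows "(\<Lambda> *\<^sub>v x) $ i =
    (if i < m then (T *\<^sub>v vec s (\<lambda>j. x $ j)) $ i else x $ pick J (i - m) + x $ (s + (i - m)))"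
proof -
  have e: "(\<Lambda> *\<^sub>v x) $ i = (\<Sum>j = 0..<s. \<Lambda> $$ (i, j) * x $ j) + (\<Sum>l = 0..<r. \<Lambda> $$ (i, s + l) * x $ (s + l))"
    using x i Lc by (simp add: index_mult_mat_vec scalar_prod_def sum_upt_add)
  show ?thesis
  proof (cases "i < m")
    case True
    have "(\<Sum>j = 0..<s. \<Lambda> $$ (i, j) * x $ j) = (\<Sum>j = 0..<s. T $$ (i, j) * x $ j)"
      using True i by (intro sum.cong) (auto simp: lawrence_omega_index)
    moreover have "(\<Sum>l = 0..<r. \<Lambda> $$ (i, s + l) * x $ (s + l)) = 0"
      using True i by (intro sum.neutral) (auto simp: lawrence_omega_index)
    moreover have "(T *\<^sub>v vec s (\<lambda>j. x $ j)) $ i = (\<Sum>j = 0..<s. T $$ (i, j) * x $ j)"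
      using True T by (auto simp: index_mult_mat_vec scalar_prod_def)
    ultimately show ?thesis using e True by simp
  next
    case False
    then have k: "i - m < r" using i by simp
    have p: "pick J (i - m) < s" using pick_in_set_le[OF k] by simp
    have "(\<Sum>j = 0..<s. \<Lambda> $$ (i, j) * x $ j) = (\<Sum>j = 0..<s. if j = pick J (i - m) then x $ j else 0)"
      using False i by (intro sum.cong) (auto simp: lawrence_omega_index)
    moreover have "(\<Sum>l = 0..<r. \<Lambda> $$ (i, s + l) * x $ (s + l)) =
        (\<Sum>l = 0..<r. if l = i - m then x $ (s + l) else 0)"
      using False i by (intro sum.cong) (auto simp: lawrence_omega_index)
    ultimately show ?thesis using e False p k by simp
  qed
qed

lemma lawrence_embedding_kernel_iff:
  assumes u: "u \<in> carrier_vec s"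
  shows "E *\<^sub>v u \<in> mat_kernel \<Lambda> \<longleftrightarrow> u \<in> mat_kernel T"
proof -
  have x: "E *\<^sub>v u \<in> carrier_vec (s + r)" using Ec u by simp
  have uu: "vec s (\<lambda>j. (E *\<^sub>v u) $ j) = u"
    using u by (intro eq_vecI) (simp_all add: lawrence_embedding_nth_less)
  have z: "(E *\<^sub>v u) $ pick J k + (E *\<^sub>v u) $ (s + k) = 0" if "k < r" for k
  proof -
    have "pick J k < s" using pick_in_set_le[OF that] by simp
    then show ?thesis
      using that u
      by (simp add: lawrence_embedding_nth_less lawrence_embedding_nth[of u "s + k"]
          lawrence_sign_def lawrence_source_def)
  qed
  have "\<Lambda> *\<^sub>v (E *\<^sub>v u) = 0\<^sub>v (m + r) \<longleftrightarrow> T *\<^sub>v u = 0\<^sub>v m"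
  proof
    assume h: "\<Lambda> *\<^sub>v (E *\<^sub>v u) = 0\<^sub>v (m + r)"
    show "T *\<^sub>v u = 0\<^sub>v m"
    proof (rule eq_vecI)
      fix i assume "i < dim_vec (0\<^sub>v m :: int vec)"
      then have i: "i < m" by simp
      have "(\<Lambda> *\<^sub>v (E *\<^sub>v u)) $ i = 0" using h i by simp
      then show "(T *\<^sub>v u) $ i = 0\<^sub>v m $ i" using lawrence_mult_nth[OF x, of i] i uu by simp
    qed (use T in simp)
  next
    assume h: "T *\<^sub>v u = 0\<^sub>v m"
    show "\<Lambda> *\<^sub>v (E *\<^sub>v u) = 0\<^sub>v (m + r)"
    proof (rule eq_vecI)
      fix i assume "i < dim_vec (0\<^sub>v (m + r) :: int vec)"
      then have i: "i < m + r" by simp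
      have "(\<Lambda> *\<^sub>v (E *\<^sub>v u)) $ i = 0"
      proof (cases "i < m")
        case True
        then show ?thesis using lawrence_mult_nth[OF x i] uu h by simp
      next
        case False
        then have "i - m < r" using i by simp
        then show ?thesis using lawrence_mult_nth[OF x i] False by (simp only: if_False z)
      qed
      then show "(\<Lambda> *\<^sub>v (E *\<^sub>v u)) $ i = 0\<^sub>v (m + r) $ i" using i by simp
    qed (use Lc in simp)
  qed
  then show ?thesis using T Lc x u by (simp add: mat_kernel_def)
qed

text \<open>
  The row of \<open>\<Lambda>(T)_\<omega>\<close> for \<open>i \<notin> \<omega>\<close> forces the two copies of \<open>i\<close> to be opposite, and the rows of
  \<open>T\<close> see only the first copies.
\<close>

lemma lawrence_kernel: "mat_kernel \<Lambda> = (\<lambda>u. E *\<^sub>v u) ` mat_kernel T"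
proof
  show "(\<lambda>u. E *\<^sub>v u) ` mat_kernel T \<subseteq> mat_kernel \<Lambda>"
    using lawrence_embedding_kernel_iff carrier_mat_kernel[of _ T] T by auto
  show "mat_kernel \<Lambda> \<subseteq> (\<lambda>u. E *\<^sub>v u) ` mat_kernel T"
  proof
    fix x assume xk: "x \<in> mat_kernel \<Lambda>"
    then have x: "x \<in> carrier_vec (s + r)" and h: "\<Lambda> *\<^sub>v x = 0\<^sub>v (m + r)"
      using Lc by (auto simp: mat_kernel_def)
    define u where "u = vec s (\<lambda>j. x $ j)"
    have u: "u \<in> carrier_vec s" by (simp add: u_def)
    have "x = E *\<^sub>v u"
    proof (rule eq_vecI)
      fix j assume "j < dim_vec (E *\<^sub>v u)"
      then have j: "j < s + r" using Ec by simp
      show "x $ j = (E *\<^sub>v u) $ j"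
      proof (cases "j < s")
        case True
        then show ?thesis using lawrence_embedding_nth_less[OF u True] by (simp add: u_def)
      next
        case False
        define k where "k = j - s"
        have k: "k < r" "j = s + k" using j False by (auto simp: k_def)
        have "(\<Lambda> *\<^sub>v x) $ (m + k) = 0" using h k by simp
        then have "x $ pick J k + x $ (s + k) = 0"
          using lawrence_mult_nth[OF x, of "m + k"] k by simp
        moreover have "pick J k < s" using pick_in_set_le[OF k(1)] by simp
        ultimately show ?thesis
          using lawrence_embedding_nth[OF u j] k(2)
          by (simp add: lawrence_sign_def lawrence_source_def u_def)
      qed
    qed (use x Ec in simp)
    then show "x \<in> (\<lambda>u. E *\<^sub>v u) ` mat_kernel T"
      using lawrence_embedding_kernel_iff[OF u] xk by blast
  qed
qed

text \<open>
  The embedding preserves and reflects the conformal order, and the Graver vectors are the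
  minimal nonzero kernel vectors for this order.
\<close>

lemma lawrence_graver: "graver K \<Lambda> = (\<lambda>u. E *\<^sub>v u) ` graver K T"
proof -
  have d: "dim_col \<Lambda> = s + r" "dim_col T = s" using Lc T by auto
  have c: "v \<in> carrier_vec s" if "v \<in> mat_kernel T" for v
    using carrier_mat_kernel[OF that] d by simp
  have "E *\<^sub>v u \<in> graver K \<Lambda> \<longleftrightarrow> u \<in> graver K T" if u: "u \<in> mat_kernel T" for u
  proof -
    have "(E *\<^sub>v v \<noteq> 0\<^sub>v (s + r) \<longrightarrow> conformal_le (E *\<^sub>v v) (E *\<^sub>v u) \<longrightarrow> E *\<^sub>v v = E *\<^sub>v u) \<longleftrightarrow>
      (v \<noteq> 0\<^sub>v s \<longrightarrow> conformal_le v u \<longrightarrow> v = u)" if "v \<in> mat_kernel T" for v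
      using lawrence_embedding_conformal_le[OF c[OF u] c[OF that]]
        lawrence_embedding_eq_zero_iff[OF c[OF that]] inj_on_eq_iff[OF lawrence_embedding_inj c[OF that] c[OF u]]
      by simp
    then show ?thesis
      unfolding graver_iff d lawrence_kernel ball_simps
      using u lawrence_embedding_eq_zero_iff[OF c[OF u]] by auto
  qed
  then show ?thesis
    using graver_subset_mat_kernel[of K T] graver_subset_mat_kernel[of K \<Lambda>] unfolding lawrence_kernel
    by blast
qed

lemma lawrence_positively_graded:
  assumes "positively_graded T"
  shows "positively_graded \<Lambda>"
proof -
  have d: "dim_col \<Lambda> = s + r" "dim_col T = s" using Lc T by auto
  have "x = 0\<^sub>v (s + r)" if xk: "x \<in> mat_kernel \<Lambda>" and nn: "\<forall>i<dim_vec x. 0 \<le> x $ i" for x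
  proof -
    obtain u where u: "u \<in> mat_kernel T" "x = E *\<^sub>v u" using xk lawrence_kernel by blast
    have c: "u \<in> carrier_vec s" using carrier_mat_kernel[OF u(1)] d by simp
    have "u = 0\<^sub>v (dim_col T)"
    proof (rule positively_gradedD[OF assms u(1)])
      fix i assume "i < dim_col T"
      then have i: "i < s" using d by simp
      have "0 \<le> x $ i" using nn i u(2) Ec by simp
      then show "0 \<le> u $ i" using lawrence_embedding_nth_less[OF c i] u(2) by simp
    qed
    then show ?thesis using lawrence_embedding_eq_zero_iff[OF c] u(2) d by simp
  qed
  moreover have "0\<^sub>v (s + r) \<in> mat_kernel \<Lambda>" using zero_mat_kernel[of \<Lambda>] by (simp only: d)
  moreover have "0\<^sub>v (s + r) \<in> {u :: int vec. \<forall>i<dim_vec u. 0 \<le> u $ i}" by simp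
  ultimately show ?thesis unfolding positively_graded_def d by blast
qed

text \<open>
  The reason why \<open>S_\<omega>(T)\<close> does not depend on the chosen \<open>T_\<omega>\<close>-robust ideal, in the direction from
  \<open>\<Lambda>(T)_\<omega>\<close> to any other one. On the bouquet \<open>B_i\<close>, the image of \<open>v\<close> is \<open>v_i\<close> times the
  bouquet vector. If \<open>B_i\<close> is non-mixed, this vector is positive and semiconformality at the
  coordinate \<open>i\<close> is enough. If \<open>B_i\<close> is mixed, its entries have arbitrary signs, but then
  \<open>\<Lambda>(T)_\<omega>\<close> has both \<open>v_i\<close> and \<open>- v_i\<close> among its coordinates. On the free bouquet all kernel
  vectors vanish.
\<close>

lemma splits_transfer:
  fixes K :: "'k::field itself"
  assumes TR: "T_robust K T \<omega> A G Bs C" and u: "u \<in> mat_kernel T"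
    and sp: "splits (mat_kernel \<Lambda>) (E *\<^sub>v u)"
  shows "splits (mat_kernel A) (C *\<^sub>v u)"
proof -
  have d: "dim_col T = s" using T by simp
  have bd: "bouquet_decomposition A G Bs C" and len: "length Bs = s"
    and tor: "toric_ideal K (A * C) = toric_ideal K T"
    and mix: "\<And>i. i < s \<Longrightarrow> \<not> free_bouquet G (set (Bs ! i)) \<Longrightarrow> i \<in> \<omega> \<Longrightarrow> non_mixed_bouquet G (set (Bs ! i))"
    using TR d by (auto simp: T_robust_def)
  have C: "C \<in> carrier_mat (dim_col A) s" and gt: "gale_transform A G"
    and bq: "set ` set Bs = bouquets G"
    and bv: "\<And>i. i < s \<Longrightarrow> bouquet_vector G (Bs ! i) (col C i)"
    using bd len by (auto simp: bouquet_decomposition_def)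
  have g: "dim_row G = dim_col A" using gt by (simp add: gale_transform_def)
  have B: "set (Bs ! i) \<in> bouquets G" if "i < s" for i
    using bq that len by (metis image_eqI nth_mem)
  have ker: "mat_kernel (A * C) = mat_kernel T"
    by (rule toric_ideal_eqD[OF tor]) (use C d in simp)
  have CA: "C *\<^sub>v x \<in> mat_kernel A" if "x \<in> mat_kernel T" for x
  proof -
    have x: "x \<in> carrier_vec s" using carrier_mat_kernel[OF that] d by simp
    have "(A * C) *\<^sub>v x = 0\<^sub>v (dim_row A)" using that unfolding ker[symmetric] by (simp add: mat_kernel_def)
    then have "A *\<^sub>v (C *\<^sub>v x) = 0\<^sub>v (dim_row A)"
      using assoc_mult_mat_vec[of A "dim_row A" "dim_col A" C s x] C x by simp
    then show ?thesis using C x by (simp add: mat_kernel_def)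
  qed
  have nth: "(C *\<^sub>v x) $ j = C $$ (j, i) * x $ i"
    if "x \<in> carrier_vec s" "i < s" "j \<in> set (Bs ! i)" for x i j
    using bouquet_map_nth[OF bd] that len by simp
  have jless: "j < dim_col A" if "i < s" "j \<in> set (Bs ! i)" for i j
    using bouquet_nonempty[OF B[OF that(1)]] that(2) g by auto
  have nz: "C *\<^sub>v x \<noteq> 0\<^sub>v (dim_col A)" if x: "x \<in> carrier_vec s" "x \<noteq> 0\<^sub>v s" for x
  proof -
    obtain i where i: "i < s" "x $ i \<noteq> 0"
      using x by (metis carrier_vecD eq_vecI index_zero_vec)
    obtain j where j: "j \<in> set (Bs ! i)"
      using bouquet_nonempty[OF B[OF i(1)], THEN conjunct1] by (meson ex_in_conv)
    have "C $$ (j, i) \<noteq> 0"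
      using bouquet_vector_nonzero[OF bv[OF i(1)] j] C i(1) jless[OF i(1) j] by simp
    then have "(C *\<^sub>v x) $ j \<noteq> 0" using nth[OF x(1) i(1) j] i(2) by simp
    then show ?thesis using jless[OF i(1) j] by auto
  qed
  obtain v' w' where vw': "v' \<in> mat_kernel \<Lambda>" "w' \<in> mat_kernel \<Lambda>"
    "v' \<noteq> 0\<^sub>v (dim_vec (E *\<^sub>v u))" "w' \<noteq> 0\<^sub>v (dim_vec (E *\<^sub>v u))" "E *\<^sub>v u = v' + w'" "semiconformal v' w'"
    using sp unfolding splits_def by blast
  obtain v w where v: "v \<in> mat_kernel T" "v' = E *\<^sub>v v" and w: "w \<in> mat_kernel T" "w' = E *\<^sub>v w"
    using vw'(1,2) unfolding lawrence_kernel by blast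
  have uc: "u \<in> carrier_vec s" and vc: "v \<in> carrier_vec s" and wc: "w \<in> carrier_vec s"
    using u v w carrier_mat_kernel d by metis+
  have E0: "E *\<^sub>v 0\<^sub>v s = 0\<^sub>v (s + r)" using lawrence_embedding_eq_zero_iff zero_carrier_vec by blast
  have dimE: "dim_vec (E *\<^sub>v u) = s + r" using Ec by simp
  have "v \<noteq> 0\<^sub>v s" "w \<noteq> 0\<^sub>v s" using vw'(3,4) v(2) w(2) E0 dimE by auto
  have "E *\<^sub>v u = E *\<^sub>v (v + w)"
    using vw'(5) v(2) w(2) mult_add_distrib_mat_vec[OF Ec vc wc] by simp
  then have uvw: "u = v + w" using inj_onD[OF lawrence_embedding_inj] uc vc wc by simp
  have sc: "0 < lawrence_sign s j * v $ src j \<longrightarrow> 0 \<le> lawrence_sign s j * w $ src j"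
    if "j < s + r" for j
  proof -
    have "0 < (E *\<^sub>v v) $ j \<longrightarrow> 0 \<le> (E *\<^sub>v w) $ j"
      using vw'(6) that Ec unfolding semiconformal_def v(2) w(2) by simp
    then show ?thesis by (simp only: lawrence_embedding_nth[OF vc that] lawrence_embedding_nth[OF wc that])
  qed
  have "semiconformal (C *\<^sub>v v) (C *\<^sub>v w)"
    unfolding semiconformal_def
  proof (intro allI impI)
    fix j assume "j < dim_vec (C *\<^sub>v v)" and pos: "0 < (C *\<^sub>v v) $ j"
    then have j: "j < dim_row G" using C g by simp
    obtain i where i: "i < s" "j \<in> set (Bs ! i)"
      using in_some_bouquet[OF j] bq len by (metis image_iff in_set_conv_nth)
    have nf: "\<not> free_bouquet G (set (Bs ! i))"
      using kernel_zero_on_free[OF gt CA[OF v(1)] _ i(2) j] pos by auto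
    have cpos: "0 < C $$ (j, i) * v $ i" using pos nth[OF vc i] by simp
    have sci: "0 < v $ i \<longrightarrow> 0 \<le> w $ i"
      using sc[of i] i(1) by (simp add: lawrence_sign_def lawrence_source_def)
    have "0 \<le> C $$ (j, i) * w $ i"
    proof (cases "i \<in> \<omega>")
      case True
      have "0 < col C i $ j"
        using bouquet_vector_pos[OF bv[OF i(1)] i(2) B[OF i(1)] mix[OF i(1) nf True]] .
      then have "0 < C $$ (j, i)" using C i(1) jless[OF i] by simp
      then show ?thesis using cpos sci by (simp add: zero_less_mult_iff)
    next
      case False
      let ?k = "s + card {a \<in> J. a < i}"
      have "?k \<in> set (lawrence_copies s \<omega> i)" using False by (simp add: lawrence_copies_def)
      then have "?k < s + r" "src ?k = i" using lawrence_copies_set[OF i(1)] by auto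
      then have "v $ i < 0 \<longrightarrow> w $ i \<le> 0" using sc[of ?k] by (simp add: lawrence_sign_def)
      then show ?thesis using cpos sci by (auto simp: zero_less_mult_iff zero_le_mult_iff)
    qed
    then show "0 \<le> (C *\<^sub>v w) $ j" using nth[OF wc i] by simp
  qed
  moreover have "C *\<^sub>v u = C *\<^sub>v v + C *\<^sub>v w"
    unfolding uvw by (rule mult_add_distrib_mat_vec[OF C vc wc])
  moreover have "dim_vec (C *\<^sub>v u) = dim_col A" using C by simp
  ultimately show ?thesis
    unfolding splits_def using CA[OF v(1)] CA[OF w(1)] nz[OF vc \<open>v \<noteq> 0\<^sub>v s\<close>] nz[OF wc \<open>w \<noteq> 0\<^sub>v s\<close>]
    by metis
qed

text \<open>
  The row of the new Gale transform at a copy of \<open>i\<close> is the \<open>i\<close>-th row of \<open>G\<close> up to sign. As \<open>T\<close> is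
  simple, two rows with different sources are never multiples of each other in both directions, so
  the bouquets are the sets of copies.
  A variable in \<open>\<omega>\<close> has one copy only; any other has two of opposite sign, whose bouquet is mixed
  unless it is free.
\<close>

lemma lawrence_T_robust:
  fixes K :: "'k::field itself"
  assumes pg: "positively_graded T" and gt: "gale_transform T G"
    and simple: "\<forall>B\<in>bouquets G. is_singleton B"
  shows "T_robust K T \<omega> \<Lambda> (E * G) (map (lawrence_copies s \<omega>) [0..<s]) E"
proof -
  let ?B = "lawrence_copies s \<omega>" and ?sg = "lawrence_sign s"
  define H where "H = E * G"
  have d: "dim_col \<Lambda> = s + r" "dim_col T = s" using Lc T by auto
  have Gs: "dim_row G = s" using gt d by (simp add: gale_transform_def)
  then have Gc: "G \<in> carrier_mat s (dim_col G)" by auto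
  have GGc: "H \<in> carrier_mat (s + r) (dim_col G)" unfolding H_def using Ec Gc by (rule mult_carrier_mat)
  have Hd: "dim_row H = s + r" "dim_col H = dim_col G" using GGc by auto
  have Gi: "H $$ (j, l) = ?sg j * G $$ (src j, l)" if "j < s + r" "l < dim_col G" for j l
  proof -
    have j: "j < dim_row E" using that(1) by (simp add: lawrence_embedding_def)
    have "H $$ (j, l) = row E j \<bullet> col G l" unfolding H_def using j that(2) by (rule index_mult_mat(1))
    also have "\<dots> = (E *\<^sub>v col G l) $ j" using j by (rule index_mult_mat_vec[symmetric])
    also have "\<dots> = ?sg j * col G l $ src j"
      by (rule lawrence_embedding_nth) (use that Gs col_dim[of G l] in auto)
    also have "col G l $ src j = G $$ (src j, l)"
      using lawrence_source_less[OF that(1)] that(2) Gs by (intro index_col) auto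
    finally show ?thesis .
  qed
  have sg2: "rat_of_int (?sg j) * rat_of_int (?sg j) = 1" for j by (simp add: lawrence_sign_def)
  have noedge: "bouquet_edges G = {}" using simple by (rule simple_no_edges)
  have multiple: "\<exists>c'. gale_row G (src i) = c' \<cdot>\<^sub>v gale_row G (src j)"
    if ij: "i < s + r" "j < s + r" and c: "gale_row H i = c \<cdot>\<^sub>v gale_row H j" for i j c
  proof -
    \<comment> \<open>The signs are their own inverses, so they can be moved to the other side.\<close>
    let ?c = "rat_of_int (?sg i) * c * rat_of_int (?sg j)"
    have "rat_of_int (G $$ (src i, l)) = ?c * rat_of_int (G $$ (src j, l))" if l: "l < dim_col G" for l
    proof -
      have "rat_of_int (H $$ (i, l)) = c * rat_of_int (H $$ (j, l))"
        using c gale_row_eq_iff[of i H j c] ij Hd l by simp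
      then have "rat_of_int (?sg i) * rat_of_int (G $$ (src i, l)) =
          c * (rat_of_int (?sg j) * rat_of_int (G $$ (src j, l)))"
        using Gi[OF ij(1) l] Gi[OF ij(2) l] by simp
      then have "rat_of_int (?sg i) * (rat_of_int (?sg i) * rat_of_int (G $$ (src i, l))) =
          ?c * rat_of_int (G $$ (src j, l))" by simp
      then show ?thesis using sg2[of i] by (simp only: mult.assoc[symmetric] mult_1_left)
    qed
    then show ?thesis
      using gale_row_eq_iff[of "src i" G "src j"] lawrence_source_less[OF ij(1)] lawrence_source_less[OF ij(2)] Gs
      by blast
  qed
  have ratio: "gale_row H i = rat_of_int (?sg i * ?sg j) \<cdot>\<^sub>v gale_row H j"
    if ij: "i < s + r" "j < s + r" "src i = src j" for i j
    using gale_row_eq_iff[of i H j] ij Hd Gi sg2[of j] by (simp add: lawrence_sign_def)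
  have edges: "(i, j) \<in> bouquet_edges H \<longleftrightarrow> i < s + r \<and> j < s + r \<and> i \<noteq> j \<and> src i = src j" for i j
  proof
    assume "(i, j) \<in> bouquet_edges H"
    then have ij: "i < s + r" "j < s + r" "i \<noteq> j"
      and c: "\<exists>c. gale_row H i = c \<cdot>\<^sub>v gale_row H j" "\<exists>c. gale_row H j = c \<cdot>\<^sub>v gale_row H i"
      using Hd by (auto simp: bouquet_edges_def)
    have "(src i, src j) \<notin> bouquet_edges G" using noedge by simp
    then have "src i = src j"
      using multiple[OF ij(1,2)] multiple[OF ij(2,1)] c
        lawrence_source_less[OF ij(1)] lawrence_source_less[OF ij(2)] Gs
      unfolding bouquet_edges_def by blast
    then show "i < s + r \<and> j < s + r \<and> i \<noteq> j \<and> src i = src j" using ij by simp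
  next
    assume "i < s + r \<and> j < s + r \<and> i \<noteq> j \<and> src i = src j"
    then show "(i, j) \<in> bouquet_edges H"
      using ratio[of i j] ratio[of j i] Hd unfolding bouquet_edges_def by auto
  qed
  have cls: "(bouquet_edges H)\<^sup>* `` {j} = set (?B (src j))" if j: "j < s + r" for j
  proof -
    have sub: "(j, k) \<in> (bouquet_edges H)\<^sup>* \<Longrightarrow> k < s + r \<and> src k = src j" for k
      by (induction rule: rtrancl_induct) (use j edges in auto)
    have sup: "(j, k) \<in> (bouquet_edges H)\<^sup>*" if "k < s + r" "src k = src j" for k
    proof (cases "k = j")
      case False
      then have "(j, k) \<in> bouquet_edges H" using edges that j by simp
      then show ?thesis by blast
    qed simp
    show ?thesis
    proof (rule Set.set_eqI)
      fix k
      show "k \<in> (bouquet_edges H)\<^sup>* `` {j} \<longleftrightarrow> k \<in> set (?B (src j))"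
        unfolding lawrence_copies_set[OF lawrence_source_less[OF j]] Image_singleton_iff mem_Collect_eq
        using sub[of k] sup[of k] by metis
    qed
  qed
  have bq: "bouquets H = (\<lambda>i. set (?B i)) ` {..<s}"
  proof -
    have "bouquets H = (\<lambda>j. set (?B (src j))) ` {..<s + r}"
      unfolding bouquets_def quotient_def UNION_singleton_eq_range Hd
      by (intro image_cong) (simp_all add: cls)
    also have "\<dots> = (\<lambda>i. set (?B i)) ` (src ` {..<s + r})" by (simp add: image_image)
    also have "src ` {..<s + r} = {..<s}"
    proof
      show "src ` {..<s + r} \<subseteq> {..<s}" using lawrence_source_less by blast
      show "{..<s} \<subseteq> src ` {..<s + r}"
      proof
        fix i assume "i \<in> {..<s}"
        then show "i \<in> src ` {..<s + r}" by (intro image_eqI[of _ _ i]) (auto simp: lawrence_source_def)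
      qed
    qed
    finally show ?thesis .
  qed
  have hd: "hd (?B i) = i" for i by (simp add: lawrence_copies_def)
  have dis: "distinct (concat (map ?B [0..<s]))"
  proof (rule distinct_concat)
    show "distinct (map ?B [0..<s])"
      unfolding distinct_map using hd by (metis distinct_upt inj_onI)
    show "distinct ys" if "ys \<in> set (map ?B [0..<s])" for ys
      using that by (auto simp: lawrence_copies_def)
    show "set ys \<inter> set zs = {}"
      if "ys \<in> set (map ?B [0..<s])" "zs \<in> set (map ?B [0..<s])" "ys \<noteq> zs" for ys zs
      using that lawrence_copies_set by auto
  qed
  have bv: "bouquet_vector H (?B i) (col E i)" if i: "i < s" for i
  proof -
    have Eji: "col E i $ j = (if src j = i then ?sg j else 0)" if "j < s + r" for j
      using that i Ec lawrence_embedding_index[OF that i] by simp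
    have mem: "j \<in> set (?B i) \<longleftrightarrow> j < s + r \<and> src j = i" for j
      using lawrence_copies_set[OF i] by blast
    have sii: "src i = i" using i by (simp add: lawrence_source_def)
    have ii: "i \<in> set (?B i)" using mem i sii by simp
    have "if free_bouquet H (set (?B i))
     then (\<forall>j\<in>set (?B i). col E i $ j \<noteq> 0) \<and> col E i $ hd (?B i) > 0
     else \<exists>l<dim_col H. (\<forall>j\<in>set (?B i). H $$ (j, l) \<noteq> 0) \<and>
       (\<forall>j\<in>set (?B i). col E i $ j =
          sgn (H $$ (hd (?B i), l)) * (H $$ (j, l) div Gcd ((\<lambda>i. H $$ (i, l)) ` set (?B i))))"
    proof (cases "free_bouquet H (set (?B i))")
      case True
      have "\<forall>j\<in>set (?B i). col E i $ j \<noteq> 0"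
        using mem Eji by (simp add: lawrence_sign_def)
      moreover have "col E i $ hd (?B i) > 0" using Eji[of i] i sii by (simp add: hd lawrence_sign_def)
      ultimately show ?thesis using True by simp
    next
      case False
      then obtain j where j: "j \<in> set (?B i)" "\<not> free_index H j" by (auto simp: free_bouquet_def)
      then have jl: "j < s + r" "src j = i" using mem by auto
      have "\<exists>l<dim_col G. H $$ (j, l) \<noteq> 0"
      proof (rule ccontr)
        assume "\<not> ?thesis"
        then have "row H j = 0\<^sub>v (dim_col H)" using jl Hd by (intro eq_vecI) auto
        then show False using j(2) by (simp add: free_index_def)
      qed
      then obtain l where l: "l < dim_col G" "G $$ (i, l) \<noteq> 0" using Gi[OF jl(1)] jl(2) by auto
      define g where "g = G $$ (i, l)"
      have Gg: "H $$ (k, l) = ?sg k * g" if "k \<in> set (?B i)" for k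
        using Gi[of k l] that mem l(1) by (simp add: g_def)
      have gcd: "Gcd ((\<lambda>k. H $$ (k, l)) ` set (?B i)) = \<bar>g\<bar>"
      proof (rule Gcd_eqI)
        show "normalize \<bar>g\<bar> = \<bar>g\<bar>" by simp
        show "\<bar>g\<bar> dvd b" if "b \<in> (\<lambda>k. H $$ (k, l)) ` set (?B i)" for b
          using that Gg by auto
        show "c dvd \<bar>g\<bar>" if "\<And>b. b \<in> (\<lambda>k. H $$ (k, l)) ` set (?B i) \<Longrightarrow> c dvd b" for c
        proof -
          have "c dvd H $$ (i, l)" using that ii by blast
          then show ?thesis using Gg[OF ii] i by (simp add: lawrence_sign_def)
        qed
      qed
      have colk: "col E i $ k = sgn (H $$ (i, l)) * (H $$ (k, l) div \<bar>g\<bar>)" if k: "k \<in> set (?B i)" for k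
      proof -
        have "col E i $ k = ?sg k" using Eji[of k] mem[of k] k by simp
        moreover have "sgn (H $$ (i, l)) = sgn g" using Gg[OF ii] i by (simp add: lawrence_sign_def)
        \<comment> \<open>The gcd of the entries \<open>g\<close> and \<open>- g\<close> is \<open>|g|\<close>, so dividing by it leaves only signs.\<close>
        moreover have "?sg k * g div \<bar>g\<bar> = ?sg k * sgn g"
        proof -
          have "?sg k * g = ?sg k * sgn g * \<bar>g\<bar>" by (simp add: mult.assoc sgn_mult_abs)
          moreover have "\<bar>g\<bar> \<noteq> 0" using l(2) by (simp add: g_def)
          ultimately show ?thesis by (metis nonzero_mult_div_cancel_right)
        qed
        moreover have "sgn g * sgn g = 1" using l(2) by (simp add: g_def sgn_if)
        ultimately show ?thesis using Gg[OF k] by (simp add: mult.left_commute)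
      qed
      have nzk: "\<forall>k\<in>set (?B i). H $$ (k, l) \<noteq> 0"
        using Gg l(2) by (simp add: g_def lawrence_sign_def)
      have "l < dim_col H" using l(1) Hd by simp
      then show ?thesis
        unfolding if_not_P[OF False] hd
        using nzk colk by (intro exI[of _ l] conjI ballI) (simp_all only: gcd not_False_eq_True)
    qed
    moreover have "col E i \<in> carrier_vec (dim_row H)" using col_dim[of E i] Ec Hd by simp
    moreover have "\<forall>j<dim_row H. j \<notin> set (?B i) \<longrightarrow> col E i $ j = 0"
      using Eji mem Hd by simp
    ultimately show ?thesis unfolding bouquet_vector_def by blast
  qed
  have gtE: "gale_transform \<Lambda> H"
    unfolding gale_transform_def
  proof
    show "dim_row H = dim_col \<Lambda>" using Hd d by simp
    have "mat_kernel T \<subseteq> carrier_vec s" using carrier_mat_kernel[of _ T] d by auto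
    then have "bij_betw (\<lambda>u. E *\<^sub>v u) (mat_kernel T) (mat_kernel \<Lambda>)"
      using lawrence_embedding_inj inj_on_subset lawrence_kernel unfolding bij_betw_def by metis
    moreover have "bij_betw (\<lambda>x. G *\<^sub>v x) (carrier_vec (dim_col G)) (mat_kernel T)"
      using gt by (simp add: gale_transform_def)
    ultimately have "bij_betw ((\<lambda>u. E *\<^sub>v u) \<circ> (\<lambda>x. G *\<^sub>v x)) (carrier_vec (dim_col G)) (mat_kernel \<Lambda>)"
      by (rule bij_betw_trans[rotated])
    moreover have "((\<lambda>u. E *\<^sub>v u) \<circ> (\<lambda>x. G *\<^sub>v x)) x = H *\<^sub>v x" if "x \<in> carrier_vec (dim_col G)" for x
      using assoc_mult_mat_vec[OF Ec Gc that] by (simp add: H_def)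
    ultimately have "bij_betw (\<lambda>x. H *\<^sub>v x) (carrier_vec (dim_col G)) (mat_kernel \<Lambda>)"
      using bij_betw_cong by (metis (no_types, lifting))
    then show "bij_betw (\<lambda>x. H *\<^sub>v x) (carrier_vec (dim_col H)) (mat_kernel \<Lambda>)" by (simp add: Hd)
  qed
  have "bouquet_decomposition \<Lambda> H (map ?B [0..<s]) E"
    unfolding bouquet_decomposition_def using gtE dis Ec bv bq d
    by (simp add: image_image atLeast0LessThan)
  moreover have "toric_ideal K (\<Lambda> * E) = toric_ideal K T"
  proof -
    have LE: "\<Lambda> * E \<in> carrier_mat (m + r) s" using Lc Ec by (rule mult_carrier_mat)
    have "u \<in> mat_kernel (\<Lambda> * E) \<longleftrightarrow> u \<in> mat_kernel T" for u
    proof (cases "u \<in> carrier_vec s")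
      case True
      have "u \<in> mat_kernel (\<Lambda> * E) \<longleftrightarrow> E *\<^sub>v u \<in> mat_kernel \<Lambda>"
        using True LE Lc Ec assoc_mult_mat_vec[OF Lc Ec True] by (simp add: mat_kernel_def)
      then show ?thesis using lawrence_embedding_kernel_iff[OF True] by simp
    next
      case False
      then show ?thesis using LE T by (auto simp: mat_kernel_def)
    qed
    then have "mat_kernel (\<Lambda> * E) = mat_kernel T" by blast
    then show ?thesis using Ec d unfolding toric_ideal_def by simp
  qed
  moreover have "i \<in> \<omega> \<longleftrightarrow> non_mixed_bouquet H (set (?B i))"
    if i: "i < s" and nf: "\<not> free_bouquet H (set (?B i))" for i
  proof (cases "i \<in> \<omega>")
    case True
    then have "set (?B i) = {i}" by (simp add: lawrence_copies_def)
    then have "\<not> mixed_bouquet H (set (?B i))" using edges by (simp add: mixed_bouquet_def)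
    then show ?thesis using True nf by (simp add: non_mixed_bouquet_def)
  next
    case False
    let ?k = "s + card {a \<in> J. a < i}"
    have B: "i \<in> set (?B i)" "?k \<in> set (?B i)" using False by (auto simp: lawrence_copies_def)
    then have k: "?k < s + r" "src ?k = i" "src i = i" "i < s + r"
      using lawrence_copies_set[OF i] by auto
    have "(i, ?k) \<in> bouquet_edges H" using edges k i by simp
    moreover have "gale_row H i = (- 1) \<cdot>\<^sub>v gale_row H ?k"
      using ratio[of i ?k] k i by (simp add: lawrence_sign_def)
    then have "\<exists>c<0. gale_row H i = c \<cdot>\<^sub>v gale_row H ?k"
      by (intro exI[of _ "- 1"] conjI) simp_all
    ultimately have "mixed_bouquet H (set (?B i))"
      unfolding mixed_bouquet_def using nf B by blast
    then show ?thesis using False by (simp add: non_mixed_bouquet_def)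
  qed
  ultimately show ?thesis
    unfolding T_robust_def H_def[symmetric] using lawrence_positively_graded[OF pg] d by auto
qed

end

end

section \<open>The strongly robustness complex\<close>

theorem theorem3p7:
  fixes K :: "'k::field itself"
    and T :: "int mat" and m s :: nat and \<omega> :: "nat set"
  assumes "T \<in> carrier_mat m s"
    and "positively_graded T"
    and "simple_toric T"
    and "\<omega> \<subseteq> {..<s}"
  shows "\<omega> \<in> strongly_robustness_complex K T \<longleftrightarrow> strongly_robust K (lawrence_omega T \<omega>)"
proof -
  note T = assms(1) and pg = assms(2) and \<omega> = assms(4)
  let ?L = "lawrence_omega T \<omega>" and ?E = "lawrence_embedding s \<omega>"
  have d: "dim_col T = s" using T by simp
  have pgL: "positively_graded ?L" using lawrence_positively_graded[OF T \<omega> pg] .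
  have robust: "strongly_robust K ?L \<longleftrightarrow> (\<forall>u\<in>graver K T. \<not> splits (mat_kernel ?L) (?E *\<^sub>v u))"
    unfolding strongly_robust_iff[OF pgL] lawrence_graver[OF T \<omega>] by blast
  obtain G where gt: "gale_transform T G" and sing: "\<forall>B\<in>bouquets G. is_singleton B"
    using assms(3) unfolding simple_toric_def by blast
  note LT = lawrence_T_robust[OF T \<omega> pg gt sing, of K]
  have gk: "u \<in> mat_kernel T" if "u \<in> graver K T" for u
    using that by (simp add: graver_iff)
  have "S_omega K T \<omega> \<subseteq> graver K T" by (simp add: S_omega_def)
  then have face: "\<omega> \<in> strongly_robustness_complex K T \<longleftrightarrow> graver K T \<subseteq> S_omega K T \<omega>"
    unfolding strongly_robustness_complex_def mem_Collect_eq d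
    using \<omega> by (metis subset_antisym order_refl)
  show ?thesis
    unfolding robust face
  proof
    assume h: "graver K T \<subseteq> S_omega K T \<omega>"
    show "\<forall>u\<in>graver K T. \<not> splits (mat_kernel ?L) (?E *\<^sub>v u)"
    proof (intro ballI notI)
      fix u assume u: "u \<in> graver K T" and sp: "splits (mat_kernel ?L) (?E *\<^sub>v u)"
      have "u \<in> S_omega K T \<omega>" using h u by blast
      then obtain A G' Bs C where TR: "T_robust K T \<omega> A G' Bs C" and ind: "C *\<^sub>v u \<in> indispensable K A"
        unfolding S_omega_def bouquet_map_def by blast
      have "splits (mat_kernel A) (C *\<^sub>v u)" using splits_transfer[OF T \<omega> TR gk[OF u] sp] .
      moreover have "positively_graded A" using TR by (simp add: T_robust_def)
      moreover have "C *\<^sub>v u \<in> mat_kernel A" using ind by (simp add: indispensable_def)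
      ultimately show False using indispensable_iff[of A "C *\<^sub>v u" K] ind by blast
    qed
  next
    assume h: "\<forall>u\<in>graver K T. \<not> splits (mat_kernel ?L) (?E *\<^sub>v u)"
    show "graver K T \<subseteq> S_omega K T \<omega>"
    proof
      fix u assume u: "u \<in> graver K T"
      have ker: "?E *\<^sub>v u \<in> mat_kernel ?L" unfolding lawrence_kernel[OF T \<omega>] using gk[OF u] by blast
      have "?E *\<^sub>v u \<in> graver K ?L" unfolding lawrence_graver[OF T \<omega>] using u by blast
      then have "?E *\<^sub>v u \<noteq> 0\<^sub>v (dim_col ?L)" by (simp add: graver_iff)
      then have "?E *\<^sub>v u \<in> indispensable K ?L" using indispensable_iff[OF pgL ker, of K] h u by blast
      then show "u \<in> S_omega K T \<omega>"
        unfolding S_omega_def bouquet_map_def using u LT by blast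
    qed
  qed
qed

end
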